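(* Let $m,k$ be positive integers with $3\leq k\leq m^2/2$, let $\Delta$ be a subgraph of $\mathbf{K}_{m,m}$ with exactly $k$ edges, and let $K=\mathrm{S}_m\times \mathrm{S}_m$, $\mathcal{D}(\Delta)$, $x_i$, $y_j$ be as defined in the context. Then: (a) $\mathcal{D}(\Delta)$ is a $2$-design if and only if the number of $2$-paths in $\Delta$ of type $\mathcal{R}$ is equal to the number of $2$-paths in $\Delta$ of type $\mathcal{C}$, and this number is $$\sum_{i=1}^m \binom{x_i}{2}=\sum_{j=1}^m \binom{y_j}{2}=\frac{k(k-1)}{2(m+1)}.$$ If these conditions hold, then $\mathcal{D}(\Delta)$ is a $2$-$(m^2,k,\lambda)$ design with $$\lambda=\frac{k(k-1)(m-1)!(m-2)!}{(m+1)|K_\Delta|}.$$ (b) $\mathcal{D}(\Delta)$ is a $3$-design if and only if the conditions in part (a) hold and also the following two additional conditions hold: (i) the number of $3$-claws in $\Delta$ of type $\mathcal{R}$ is equal to the number of $3$-claws in $\Delta$ of type $\mathcal{C}$, and this number is $$\sum_{i=1}^m \binom{x_i}{3}=\sum_{j=1}^m \binom{y_j}{3}=\frac{k(k-1)(k-2)(m-2)}{6(m+1)(m^2-2)};$$ (ii) the number of $3$-paths in $\Delta$ is $$\frac{k(k-1)(k-2)(m-1)}{(m+1)(m^2-2)}.$$ If these conditions hold, then $\mathcal{D}(\Delta)$ is a $3$-$(m^2,k,\lambda)$ design with $$\lambda=\frac{k(k-1)(k-2)(m-1)!(m-2)!}{(m+1)(m^2-2)|K_\Delta|}.$$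
   Context: Let $\mathcal{R}=\{R_1,\dots,R_m\}$ and $\mathcal{C}=\{C_1,\dots,C_m\}$ be disjoint sets of size $m$, let $\mathcal{P}=\mathcal{R}\times\mathcal{C}$, and let $\mathbf{K}_{m,m}$ be the complete bipartite graph with vertex set $\mathcal{R}\cup\mathcal{C}$ and edges all pairs $\{R,C\}$ with $R\in\mathcal{R}$, $C\in\mathcal{C}$. Subgraphs $\Delta$ of $\mathbf{K}_{m,m}$ are identified with their edge sets (isolated vertices are irrelevant). For a subgraph $\Delta$ put $B(\Delta)=\{(R,C)\in\mathcal{P} : \{R,C\}\text{ is an edge of }\Delta\}$. Let $x_i$ be the number of edges of $\Delta$ incident with $R_i$, and $y_j$ the number of edges of $\Delta$ incident with $C_j$. Let $K=\mathrm{Sym}(\mathcal{R})\times\mathrm{Sym}(\mathcal{C})\cong \mathrm{S}_m\times \mathrm{S}_m$ act on $\mathbf{K}_{m,m}$ and on $\mathcal{P}$ in the natural way, and let $K_\Delta$ be the stabiliser of $\Delta$ in $K$ (equivalently the setwise stabiliser of $B(\Delta)$). Define the incidence structure $\mathcal{D}(\Delta)=(\mathcal{P},\{B(\Delta^g) : g\in K\})$, with incidence being inclusion. An incidence structure with point set $\mathcal{P}$ and blocks that are subsets of $\mathcal{P}$ is a $t$-$(v,k,\lambda)$ design ($t,v,k,\lambda$ positive integers) if $|\mathcal{P}|=v$, every block has size $k$, and every $t$-subset of $\mathcal{P}$ lies in exactly $\lambda$ blocks; it is a $t$-design if this holds for some $v,k,\lambda$. A $u$-path in $\Delta$ is a (not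 necessarily induced) subgraph that is a path with $u$ edges and $u+1$ distinct vertices (a path and its reversal are the same). A $2$-path has type $\mathcal{R}$ if its middle vertex lies in $\mathcal{R}$, and type $\mathcal{C}$ otherwise. A $3$-claw in $\Delta$ is a subgraph isomorphic to $\mathbf{K}_{1,3}$; it has type $\mathcal{R}$ if its vertex of valency $3$ lies in $\mathcal{R}$, and type $\mathcal{C}$ if that vertex lies in $\mathcal{C}$. *)

theory Defs
  imports Complex_Main "HOL-Combinatorics.Permutations"
begin

text \<open>
  Graphs are undirected and given by their sets of edges, an edge being a two-element set of
  vertices; isolated vertices are not recorded.
\<close>

definition complete_bipartite :: "'v set \<Rightarrow> 'v set \<Rightarrow> 'v set set" where
  "complete_bipartite X Y = {{x, y} | x y. x \<in> X \<and> y \<in> Y}"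

definition valency :: "'v set set \<Rightarrow> 'v \<Rightarrow> nat" where
  "valency \<Delta> v = card {e \<in> \<Delta>. v \<in> e}"

definition path_edges :: "'v list \<Rightarrow> 'v set set" where
  "path_edges vs = {{vs ! i, vs ! Suc i} | i. Suc i < length vs}"

text \<open>Paths are subgraphs, hence sets of edges, so a path and its reversal coincide.\<close>

definition u_paths :: "nat \<Rightarrow> 'v set set \<Rightarrow> 'v set set set" where
  "u_paths u \<Delta> =
     {S. S \<subseteq> \<Delta> \<and> (\<exists>vs. distinct vs \<and> length vs = u + 1 \<and> S = path_edges vs)}"

definition middle_vertex_in :: "'v set \<Rightarrow> 'v set set \<Rightarrow> bool" where
  "middle_vertex_in X S \<longleftrightarrow>
     (\<exists>a b c. distinct [a, b, c] \<and> S = path_edges [a, b, c] \<and> b \<in> X)"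

definition three_claws :: "'v set set \<Rightarrow> 'v set set set" where
  "three_claws \<Delta> =
     {S. S \<subseteq> \<Delta> \<and>
       (\<exists>X Y. X \<inter> Y = {} \<and> card X = 1 \<and> card Y = 3 \<and> S = complete_bipartite X Y)}"

definition three_claws_of_type :: "'v set \<Rightarrow> 'v set set \<Rightarrow> 'v set set set" where
  "three_claws_of_type X \<Delta> = {S \<in> three_claws \<Delta>. \<exists>v \<in> X. valency S v = 3}"

text \<open>
  The two sides of the bipartite graph are \<open>\<R>\<close> and \<open>\<C>\<close>, assumed disjoint where they are used.
\<close>

definition sym_prod :: "'v set \<Rightarrow> 'v set \<Rightarrow> (('v \<Rightarrow> 'v) \<times> ('v \<Rightarrow> 'v)) set" where
  "sym_prod \<R> \<C> = {g. g permutes \<R>} \<times> {h. h permutes \<C>}"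

definition vertex_act :: "'v set \<Rightarrow> ('v \<Rightarrow> 'v) \<times> ('v \<Rightarrow> 'v) \<Rightarrow> 'v \<Rightarrow> 'v" where
  "vertex_act \<R> g v = (if v \<in> \<R> then fst g v else snd g v)"

definition graph_act ::
  "'v set \<Rightarrow> ('v \<Rightarrow> 'v) \<times> ('v \<Rightarrow> 'v) \<Rightarrow> 'v set set \<Rightarrow> 'v set set" where
  "graph_act \<R> g \<Delta> = (\<lambda>e. vertex_act \<R> g ` e) ` \<Delta>"

definition graph_stabiliser ::
  "'v set \<Rightarrow> 'v set \<Rightarrow> 'v set set \<Rightarrow> (('v \<Rightarrow> 'v) \<times> ('v \<Rightarrow> 'v)) set" where
  "graph_stabiliser \<R> \<C> \<Delta> = {g \<in> sym_prod \<R> \<C>. graph_act \<R> g \<Delta> = \<Delta>}"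

definition block :: "'v set \<Rightarrow> 'v set \<Rightarrow> 'v set set \<Rightarrow> ('v \<times> 'v) set" where
  "block \<R> \<C> \<Delta> = {(r, c) \<in> \<R> \<times> \<C>. {r, c} \<in> \<Delta>}"

text \<open>
  An incidence structure is a pair of a point set and a set (without repetition) of blocks.
\<close>

type_synonym 'p incidence_structure = "'p set \<times> 'p set set"

definition design_of ::
  "'v set \<Rightarrow> 'v set \<Rightarrow> 'v set set \<Rightarrow> ('v \<times> 'v) incidence_structure" where
  "design_of \<R> \<C> \<Delta> =
     (\<R> \<times> \<C>, {block \<R> \<C> (graph_act \<R> g \<Delta>) | g. g \<in> sym_prod \<R> \<C>})"

text \<open>As \<open>v > 0\<close>, the condition \<open>card P = v\<close> forces the point set to be finite.\<close>

definition is_t_v_k_design ::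
  "nat \<Rightarrow> nat \<Rightarrow> nat \<Rightarrow> nat \<Rightarrow> 'p incidence_structure \<Rightarrow> bool" where
  "is_t_v_k_design t v k l D \<longleftrightarrow>
     (case D of (P, Bs) \<Rightarrow>
        t > 0 \<and> v > 0 \<and> k > 0 \<and> l > 0 \<and>
        card P = v \<and>
        (\<forall>b \<in> Bs. b \<subseteq> P \<and> card b = k) \<and>
        (\<forall>T. T \<subseteq> P \<and> card T = t \<longrightarrow> card {b \<in> Bs. T \<subseteq> b} = l))"

definition is_t_design :: "nat \<Rightarrow> 'p incidence_structure \<Rightarrow> bool" where
  "is_t_design t D \<longleftrightarrow> (\<exists>v k l. is_t_v_k_design t v k l D)"

end

theory Submission
  imports Defs
begin

text \<open>
  Double counting the pairs \<open>(g, S)\<close> with \<open>S \<subseteq> B(\<Delta>)\<^sup>g\<close>, for \<open>S\<close> in an orbit \<open>O\<close> of \<open>K\<close> on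
  \<open>t\<close>-subsets of points, shows that a member of \<open>O\<close> lies in \<open>|K| n\<^sub>O / (|K\<^sub>\<Delta>| |O|)\<close> blocks, where
  \<open>n\<^sub>O\<close> is the number of members of \<open>O\<close> inside \<open>B(\<Delta>)\<close>. Hence there is a \<open>t\<close>-design exactly when
  every orbit is represented in \<open>B(\<Delta>)\<close> in the same proportion as in the set of all points.
  There are three orbits on pairs and six on triples. Counting the pairs in a common row (or
  column) together with a third point gives linear relations between the numbers \<open>n\<^sub>O\<close>; they, and
  the total number of \<open>t\<close>-subsets, reduce the proportionality to 2-paths, 3-claws and 3-paths.
\<close>

section \<open>Designs from the orbit of a set under a permutation group\<close>

text \<open>Rows and columns are permuted independently, so what \<open>K\<close> preserves about a
  set of points is which of them share a row and which share a column. For two or three points this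
  pattern is determined, up to reordering, by the numbers of rows and columns occupied. For four
  points it is not: a 3-path with a disjoint edge, and two disjoint 2-paths of different types, both
  occupy three rows and three columns.

  The constants are proportions in the full grid: pairs in a common row are \<open>1/(m+1)\<close>
  of all pairs, triples in a common row are \<open>(m-2)/((m+1)(m^2-2))\<close> of all triples, and
  3-paths are \<open>6(m-1)/((m+1)(m^2-2))\<close> of them.

  Part (b) contains the conditions of (a) because the row and column relations express the pair
  counts, multiplied by \<open>k - 2 > 0\<close>, through the triple counts. Conversely, once the
  pair counts, claws and 3-paths are proportional, the same relations settle shapes
  \<open>(2, 3)\<close> and \<open>(3, 2)\<close>, and the total settles the matchings.

  Blocks form a set without repetition, while the double count runs over group elements; this is how
  the order of the stabiliser enters the value of lambda.\<close>

locale perm_group =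
  fixes G :: "('p \<Rightarrow> 'p) set"
  assumes finite_G: "finite G"
    and bij_G: "g \<in> G \<Longrightarrow> bij g"
    and comp_G: "g \<in> G \<Longrightarrow> h \<in> G \<Longrightarrow> g \<circ> h \<in> G"
    and inv_G: "g \<in> G \<Longrightarrow> inv g \<in> G"
    and nonempty_G: "G \<noteq> {}"
begin

lemma id_G: "id \<in> G"
proof -
  obtain g where g: "g \<in> G" using nonempty_G by blast
  have "g \<circ> inv g = id" using bij_G[OF g] by (metis bij_is_surj surj_iff)
  with comp_G[OF g inv_G[OF g]] show ?thesis by simp
qed

lemma inv_image_G: "g \<in> G \<Longrightarrow> inv g ` g ` A = A"
  by (simp add: bij_G bij_is_inj image_inv_f_f)

lemma image_inv_G: "g \<in> G \<Longrightarrow> g ` inv g ` A = A"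
  by (simp add: bij_G bij_is_surj image_f_inv_f)

lemma subset_image_G: "g \<in> G \<Longrightarrow> g ` A \<subseteq> g ` A' \<longleftrightarrow> A \<subseteq> A'"
  by (simp add: bij_G bij_is_inj inj_image_subset_iff)

lemma card_image_G: "g \<in> G \<Longrightarrow> card (g ` A) = card A"
  by (meson bij_G bij_is_inj card_image inj_on_subset subset_UNIV)

text \<open>Left multiplication by \<open>h\<close> is a bijection of \<open>G\<close>. The free
  predicate \<open>Q\<close> lets the same fact compare cosets of the stabiliser and compare the
  translates that contain a given set.\<close>

lemma card_left_translate:
  assumes h: "h \<in> G"
  shows "card {g \<in> G. Q (h ` g ` B)} = card {g \<in> G. Q (g ` B)}"
proof -
  have "bij_betw (\<lambda>g. h \<circ> g) {g \<in> G. Q (h ` g ` B)} {g \<in> G. Q (g ` B)}"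
  proof (rule bij_betw_byWitness[where f' = "\<lambda>g. inv h \<circ> g"])
    show "\<forall>g\<in>{g \<in> G. Q (h ` g ` B)}. inv h \<circ> (h \<circ> g) = g"
      using bij_G[OF h] by (simp add: fun_eq_iff bij_is_inj)
    show "\<forall>g\<in>{g \<in> G. Q (g ` B)}. h \<circ> (inv h \<circ> g) = g"
      using bij_G[OF h] by (simp add: fun_eq_iff bij_is_surj surj_f_inv_f)
    show "(\<lambda>g. h \<circ> g) ` {g \<in> G. Q (h ` g ` B)} \<subseteq> {g \<in> G. Q (g ` B)}"
      using h comp_G by (auto simp: image_comp)
    have "h ` (inv h \<circ> g) ` B = g ` B" for g
      using image_inv_G[OF h, of "g ` B"] by (simp add: image_comp)
    then show "(\<lambda>g. inv h \<circ> g) ` {g \<in> G. Q (g ` B)} \<subseteq> {g \<in> G. Q (h ` g ` B)}"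
      using comp_G inv_G[OF h] by auto
  qed
  then show ?thesis by (rule bij_betw_same_card)
qed

lemma card_orbit_stabiliser:
  "card {b \<in> (\<lambda>g. g ` B) ` G. Q b} * card {g \<in> G. g ` B = B} = card {g \<in> G. Q (g ` B)}"
proof -
  let ?O = "{b \<in> (\<lambda>g. g ` B) ` G. Q b}"
  have fib: "card {g \<in> G. g ` B = b} = card {g \<in> G. g ` B = B}" if b: "b \<in> ?O" for b
  proof -
    obtain h where h: "h \<in> G" "b = h ` B" using b by auto
    have "h ` g ` B = h ` B \<longleftrightarrow> g ` B = B" for g
      using inj_image_eq_iff[OF bij_is_inj[OF bij_G[OF h(1)]]] .
    then show ?thesis using card_left_translate[OF h(1), of "\<lambda>A. A = b" B] h(2) by simp
  qed
  have "{g \<in> G. Q (g ` B)} = (\<Union>b\<in>?O. {g \<in> G. g ` B = b})" by auto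
  then have "card {g \<in> G. Q (g ` B)} = (\<Sum>b\<in>?O. card {g \<in> G. g ` B = b})"
    using finite_G by (simp add: card_UN_disjoint disjoint_iff)
  also have "\<dots> = (\<Sum>b\<in>?O. card {g \<in> G. g ` B = B})"
    by (rule sum.cong) (use fib in auto)
  finally show ?thesis by simp
qed

text \<open>Both inner counts are constant: the number of \<open>g\<close> with
  \<open>S \<subseteq> g\<close>
  B\<open>does not depend on\<close>S\<open>by transitivity, and the number of\<close>S\<open>inside\<close>g
  \<open>B\<close> does not depend on \<open>g\<close> because \<open>g\<close> permutes
  \<open>Ob\<close>.\<close>

lemma card_translates_containing:
  assumes "finite Ob" and T: "T \<in> Ob"
    and invariant: "\<And>g S. g \<in> G \<Longrightarrow> S \<in> Ob \<Longrightarrow> g ` S \<in> Ob"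
    and transitive: "\<And>S S'. S \<in> Ob \<Longrightarrow> S' \<in> Ob \<Longrightarrow> \<exists>g\<in>G. g ` S = S'"
  shows "card {g \<in> G. T \<subseteq> g ` B} * card Ob = card G * card {S \<in> Ob. S \<subseteq> B}"
proof -
  have 1: "card {g \<in> G. S \<subseteq> g ` B} = card {g \<in> G. T \<subseteq> g ` B}" if "S \<in> Ob" for S
  proof -
    obtain h where h: "h \<in> G" "S = h ` T" using transitive T \<open>S \<in> Ob\<close> by blast
    show ?thesis
      using card_left_translate[OF h(1), of "\<lambda>A. S \<subseteq> A" B] h subset_image_G[OF h(1)] by simp
  qed
  have 2: "card {S \<in> Ob. S \<subseteq> g ` B} = card {S \<in> Ob. S \<subseteq> B}" if g: "g \<in> G" for g
  proof -
    have "bij_betw (\<lambda>S. g ` S) {S \<in> Ob. S \<subseteq> B} {S \<in> Ob. S \<subseteq> g ` B}"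
    proof (rule bij_betw_byWitness[where f' = "\<lambda>S. inv g ` S"])
      show "\<forall>S\<in>{S \<in> Ob. S \<subseteq> B}. inv g ` g ` S = S"
        using inv_image_G[OF g] by blast
      show "\<forall>S\<in>{S \<in> Ob. S \<subseteq> g ` B}. g ` inv g ` S = S"
        using image_inv_G[OF g] by blast
      show "(\<lambda>S. g ` S) ` {S \<in> Ob. S \<subseteq> B} \<subseteq> {S \<in> Ob. S \<subseteq> g ` B}"
        using invariant[OF g] by auto
      have "inv g ` S \<subseteq> B" if "S \<subseteq> g ` B" for S
        using image_mono[OF that, of "inv g"] inv_image_G[OF g] by simp
      then show "(\<lambda>S. inv g ` S) ` {S \<in> Ob. S \<subseteq> g ` B} \<subseteq> {S \<in> Ob. S \<subseteq> B}"
        using invariant[OF inv_G[OF g]] by blast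
    qed
    then show ?thesis by (simp add: bij_betw_same_card)
  qed
  have "(\<Sum>S\<in>Ob. card {g \<in> G. S \<subseteq> g ` B}) = (\<Sum>g\<in>G. card {S \<in> Ob. S \<subseteq> g ` B})"
    using \<open>finite Ob\<close> finite_G
    by (simp only: card_eq_sum) (rule sum.swap_restrict)
  then show ?thesis by (simp add: 1 2 mult.commute)
qed

text \<open>The map \<open>ty\<close> labels the orbits on \<open>t\<close>-subsets: it is constant
  along each orbit and separates different ones. Proportions are cross-multiplied to stay within the
  natural numbers.\<close>

theorem t_design_iff:
  fixes P B :: "'p set" and ty :: "'p set \<Rightarrow> 'i" and t :: nat
  defines "v \<equiv> card P" and "k \<equiv> card B"
    and "D \<equiv> (P, (\<lambda>g. g ` B) ` G)"
    and "n \<equiv> \<lambda>A i. card {S. S \<subseteq> A \<and> card S = t \<and> ty S = i}"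
  assumes "finite P" and "B \<subseteq> P" and "0 < t" and "t \<le> k"
    and G_P: "\<And>g. g \<in> G \<Longrightarrow> g ` P = P"
    and invariant: "\<And>g S. g \<in> G \<Longrightarrow> S \<subseteq> P \<Longrightarrow> ty (g ` S) = ty S"
    and transitive: "\<And>S S'. S \<subseteq> P \<Longrightarrow> S' \<subseteq> P \<Longrightarrow> card S = t \<Longrightarrow> card S' = t \<Longrightarrow> ty S = ty S'
      \<Longrightarrow> \<exists>g\<in>G. g ` S = S'"
  shows "is_t_design t D \<longleftrightarrow> (\<forall>i. n B i * (v choose t) = n P i * (k choose t))"
    and "is_t_design t D \<Longrightarrow>
      \<exists>l. is_t_v_k_design t v k l D \<and>
        l * card {g \<in> G. g ` B = B} * (v choose t) = card G * (k choose t)"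
proof -
  define s where "s = card {g \<in> G. g ` B = B}"
  define L where "L = (\<lambda>T. card {b \<in> (\<lambda>g. g ` B) ` G. T \<subseteq> b})"
  have [simp]: "finite B" using \<open>B \<subseteq> P\<close> \<open>finite P\<close> by (rule finite_subset)
  have "s > 0" unfolding s_def using finite_G id_G by (auto simp: card_gt_0_iff)
  have "card G > 0" using finite_G nonempty_G by (simp add: card_gt_0_iff)
  have "k \<le> v" using \<open>finite P\<close> \<open>B \<subseteq> P\<close> by (simp add: k_def v_def card_mono)
  then have pos: "v choose t > 0" "k choose t > 0" using \<open>t \<le> k\<close> by simp_all
  have L: "L T * s * n P (ty T) = card G * n B (ty T)" if "T \<subseteq> P" "card T = t" for T
  proof -
    let ?O = "{S. S \<subseteq> P \<and> card S = t \<and> ty S = ty T}"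
    have "card {g \<in> G. T \<subseteq> g ` B} * card ?O = card G * card {S \<in> ?O. S \<subseteq> B}"
    proof (rule card_translates_containing)
      show "finite ?O" using \<open>finite P\<close> by simp
      show "T \<in> ?O" using that by simp
      show "g ` S \<in> ?O" if "g \<in> G" "S \<in> ?O" for g S
        using that G_P[of g] invariant[of g S] by (auto simp: card_image_G)
      show "\<exists>g\<in>G. g ` S = S'" if "S \<in> ?O" "S' \<in> ?O" for S S'
        using transitive that by simp
    qed
    moreover have "{S \<in> ?O. S \<subseteq> B} = {S. S \<subseteq> B \<and> card S = t \<and> ty S = ty T}"
      using \<open>B \<subseteq> P\<close> by auto
    ultimately show ?thesis
      using card_orbit_stabiliser[of B "\<lambda>b. T \<subseteq> b"] by (simp add: L_def s_def n_def)
  qed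
  have L_le: "n B i \<le> n P i" for i
    unfolding n_def using \<open>finite P\<close> \<open>B \<subseteq> P\<close> by (intro card_mono) auto
  have nP_pos: "n P (ty T) > 0" if "T \<subseteq> P" "card T = t" for T
    unfolding n_def using \<open>finite P\<close> that by (auto simp: card_gt_0_iff)
  have sum_n: "(\<Sum>i\<in>ty ` Pow P. n A i) = card A choose t" if "A \<subseteq> P" for A
  proof -
    have fA: "finite A" using that \<open>finite P\<close> finite_subset by blast
    have "{S. S \<subseteq> A \<and> card S = t} = (\<Union>i\<in>ty ` Pow P. {S. S \<subseteq> A \<and> card S = t \<and> ty S = i})"
      using that by auto
    moreover have "card (\<Union>i\<in>ty ` Pow P. {S. S \<subseteq> A \<and> card S = t \<and> ty S = i})
      = (\<Sum>i\<in>ty ` Pow P. n A i)"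
      unfolding n_def by (rule card_UN_disjoint) (use fA \<open>finite P\<close> in auto)
    ultimately have "card {S. S \<subseteq> A \<and> card S = t} = (\<Sum>i\<in>ty ` Pow P. n A i)" by simp
    then show ?thesis using n_subsets[OF fA] by simp
  qed
  have uniform: "n B i * (v choose t) = n P i * (k choose t)"
    if "\<And>T. T \<subseteq> P \<Longrightarrow> card T = t \<Longrightarrow> L T = l" "l > 0" for l i
  proof -
    \<comment> \<open>A type that no \<open>t\<close>-subset of \<open>P\<close> has gives
      \<open>0 = 0\<close>, since \<open>n B i \<le> n P i\<close>.\<close>
    have l: "l * s * n P i = card G * n B i" for i
    proof (cases "n P i = 0")
      case True
      then show ?thesis using L_le[of i] by simp
    next
      case False
      then have "{S. S \<subseteq> P \<and> card S = t \<and> ty S = i} \<noteq> {}"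
        unfolding n_def by (metis card.empty)
      then obtain T where "T \<subseteq> P" "card T = t" "ty T = i" by auto
      with L[of T] that(1) show ?thesis by simp
    qed
    \<comment> \<open>Summing over all types expresses \<open>l * s\<close> through the two
      binomials alone; putting this back into the equation for a single type eliminates
      \<open>l\<close>.\<close>
    have "l * s * (\<Sum>i\<in>ty ` Pow P. n P i) = card G * (\<Sum>i\<in>ty ` Pow P. n B i)"
      by (simp add: sum_distrib_left l)
    then have lt: "l * s * (v choose t) = card G * (k choose t)"
      using sum_n[of P] sum_n[OF \<open>B \<subseteq> P\<close>] by (simp add: v_def k_def)
    have "card G * (n B i * (v choose t)) = (l * s * n P i) * (v choose t)"
      by (simp add: l)
    also have "\<dots> = n P i * (l * s * (v choose t))" by (simp add: mult_ac)
    also have "\<dots> = card G * (n P i * (k choose t))" unfolding lt by (simp add: mult_ac)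
    finally show ?thesis using \<open>card G > 0\<close> by simp
  qed
  have conv: "\<exists>l. is_t_v_k_design t v k l D \<and> l * s * (v choose t) = card G * (k choose t)"
    if n: "\<forall>i. n B i * (v choose t) = n P i * (k choose t)"
  proof -
    have l: "L T * s * (v choose t) = card G * (k choose t)" if T: "T \<subseteq> P" "card T = t" for T
    proof -
      have "n P (ty T) * (L T * s * (v choose t)) = card G * (n B (ty T) * (v choose t))"
        using L[OF T] by (simp add: mult_ac)
      also have "\<dots> = n P (ty T) * (card G * (k choose t))" using n by (simp add: mult_ac)
      finally show ?thesis using nP_pos[OF T] by simp
    qed
    have "t \<le> card P" using \<open>t \<le> k\<close> \<open>k \<le> v\<close> v_def by simp
    then obtain T0 where T0: "T0 \<subseteq> P" "card T0 = t" by (meson obtain_subset_with_card_n)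
    have "L T = L T0" if "T \<subseteq> P" "card T = t" for T
    proof -
      have "L T * (s * (v choose t)) = L T0 * (s * (v choose t))"
        using l[OF that] l[OF T0] by (simp add: mult.assoc)
      then show ?thesis using \<open>s > 0\<close> pos by simp
    qed
    \<comment> \<open>A design requires a positive index, and this is what \<open>t \<le> k\<close>
      provides through \<open>k choose t > 0\<close>.\<close>
    moreover have "L T0 > 0" using l[OF T0] \<open>card G > 0\<close> pos by (metis mult_is_0 neq0_conv)
    moreover have "g ` B \<subseteq> P" if "g \<in> G" for g using G_P[OF that] \<open>B \<subseteq> P\<close> by blast
    ultimately have "is_t_v_k_design t v k (L T0) D"
      using \<open>0 < t\<close> \<open>t \<le> k\<close> \<open>k \<le> v\<close>
      by (auto simp: is_t_v_k_design_def D_def L_def v_def k_def card_image_G)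
    then show ?thesis using l[OF T0] by blast
  qed
  have fwd: "\<forall>i. n B i * (v choose t) = n P i * (k choose t)" if design: "is_t_design t D"
  proof -
    obtain v' k' l where "is_t_v_k_design t v' k' l D"
      using design unfolding is_t_design_def by blast
    then have "l > 0" "\<And>T. T \<subseteq> P \<Longrightarrow> card T = t \<Longrightarrow> L T = l"
      by (auto simp: is_t_v_k_design_def D_def L_def)
    then show ?thesis using uniform by blast
  qed
  show "is_t_design t D \<longleftrightarrow> (\<forall>i. n B i * (v choose t) = n P i * (k choose t))"
    using fwd conv unfolding is_t_design_def by blast
  show "\<exists>l. is_t_v_k_design t v k l D \<and>
      l * card {g \<in> G. g ` B = B} * (v choose t) = card G * (k choose t)" if design: "is_t_design t D"
    using conv fwd that by (simp add: s_def)
qed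

end

section \<open>Orbits on pairs and triples of points\<close>

lemma inj_on_extends_permutation:
  assumes "finite X" "A \<subseteq> X" "inj_on f A" "f ` A \<subseteq> X"
  obtains p where "p permutes X" "\<And>a. a \<in> A \<Longrightarrow> p a = f a"
proof -
  have fin: "finite A" using assms finite_subset by blast
  have "card (X - A) = card (X - f ` A)"
    using assms fin by (simp add: card_Diff_subset card_image)
  then obtain h where h: "bij_betw h (X - A) (X - f ` A)"
    using finite_same_card_bij[of "X - A" "X - f ` A"] \<open>finite X\<close> by auto
  define p where "p = (\<lambda>x. if x \<in> A then f x else if x \<in> X then h x else x)"
  have "bij_betw p A (f ` A)"
    using \<open>inj_on f A\<close> by (simp add: p_def bij_betw_def inj_on_def)
  moreover have "bij_betw p (X - A) (X - f ` A)"
    using h by (rule bij_betw_cong[THEN iffD1, rotated]) (simp add: p_def)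
  ultimately have "bij_betw p (A \<union> (X - A)) (f ` A \<union> (X - f ` A))"
    by (rule bij_betw_combine) auto
  moreover have "A \<union> (X - A) = X" "f ` A \<union> (X - f ` A) = X" using assms by auto
  ultimately have "bij_betw p X X" by simp
  then have "p permutes X"
    by (rule bij_imp_permutes) (use \<open>A \<subseteq> X\<close> in \<open>auto simp: p_def\<close>)
  then show ?thesis using that by (simp add: p_def)
qed

text \<open>Points of a set may share a row, so the tuple of their rows can repeat values. Equal
  coincidences make \<open>p i \<mapsto> q i\<close> a well-defined injection whichever index is
  chosen for a value, and an injection extends to a permutation of the finite set
  \<open>X\<close>.\<close>

lemma permutation_of_same_equality_pattern:
  fixes p q :: "'i \<Rightarrow> 'v"
  assumes "finite X" "p ` I \<subseteq> X" "q ` I \<subseteq> X"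
    and pattern: "\<And>i j. i \<in> I \<Longrightarrow> j \<in> I \<Longrightarrow> p i = p j \<longleftrightarrow> q i = q j"
  obtains g where "g permutes X" "\<And>i. i \<in> I \<Longrightarrow> g (p i) = q i"
proof -
  define f where "f = (\<lambda>a. q (SOME i. i \<in> I \<and> p i = a))"
  have f: "f (p i) = q i" if "i \<in> I" for i
  proof -
    have "(SOME j. j \<in> I \<and> p j = p i) \<in> I \<and> p (SOME j. j \<in> I \<and> p j = p i) = p i"
      by (rule someI[of _ i]) (simp add: that)
    then have "q (SOME j. j \<in> I \<and> p j = p i) = q i" using pattern that by blast
    then show ?thesis by (simp add: f_def)
  qed
  have "inj_on f (p ` I)" using f pattern by (auto simp: inj_on_def)
  moreover have "f ` p ` I \<subseteq> X" using f assms(3) by auto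
  ultimately obtain g where "g permutes X" "\<And>a. a \<in> p ` I \<Longrightarrow> g a = f a"
    using inj_on_extends_permutation[of X "p ` I" f] assms by blast
  then show ?thesis using that f by simp
qed

text \<open>
  A pair of shape \<open>(1, 2)\<close> or \<open>(2, 1)\<close> is a 2-path of type \<open>\<R>\<close> or \<open>\<C>\<close>. A triple of shape \<open>(1, 3)\<close>
  or \<open>(3, 1)\<close> is a 3-claw of type \<open>\<R>\<close> or \<open>\<C>\<close>; shape \<open>(2, 2)\<close> is a 3-path; shapes \<open>(2, 3)\<close> and
  \<open>(3, 2)\<close> are a 2-path and a disjoint edge; shape \<open>(3, 3)\<close> is a matching.
\<close>

definition shape :: "('a \<times> 'b) set \<Rightarrow> nat \<times> nat" where
  "shape T = (card (fst ` T), card (snd ` T))"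

lemma card_insert3: "card {x, y, z} =
  (if x = y then if y = z then 1 else 2 else if x = z \<or> y = z then 2 else 3)"
  by (simp add: card_insert_if)

text \<open>
  The first two points share a row if possible; in a 3-path the middle edge comes second.
\<close>

lemma triple_normal_form:
  fixes T :: "('a \<times> 'b) set"
  assumes "card T = 3"
  obtains p where "T = p ` {..<3::nat}"
    "fst (p 0) = fst (p 1) \<longleftrightarrow> card (fst ` T) \<le> 2"
    "fst (p 0) = fst (p 2) \<longleftrightarrow> card (fst ` T) = 1"
    "fst (p 1) = fst (p 2) \<longleftrightarrow> card (fst ` T) = 1"
    "snd (p 1) = snd (p 2) \<longleftrightarrow> card (snd ` T) = 1 \<or> shape T = (2, 2)"
    "snd (p 0) = snd (p 1) \<longleftrightarrow> card (snd ` T) = 1 \<or> shape T = (3, 2)"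
    "snd (p 0) = snd (p 2) \<longleftrightarrow> card (snd ` T) = 1"
proof -
  define C where "C = (\<lambda>p0 p1 p2 :: 'a \<times> 'b.
    (fst p0 = fst p1 \<longleftrightarrow> card (fst ` T) \<le> 2) \<and>
    (fst p0 = fst p2 \<longleftrightarrow> card (fst ` T) = 1) \<and>
    (fst p1 = fst p2 \<longleftrightarrow> card (fst ` T) = 1) \<and>
    (snd p1 = snd p2 \<longleftrightarrow> card (snd ` T) = 1 \<or> shape T = (2, 2)) \<and>
    (snd p0 = snd p1 \<longleftrightarrow> card (snd ` T) = 1 \<or> shape T = (3, 2)) \<and>
    (snd p0 = snd p2 \<longleftrightarrow> card (snd ` T) = 1))"
  obtain a b c where T: "T = {a, b, c}" and d: "a \<noteq> b" "a \<noteq> c" "b \<noteq> c"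
    using assms by (auto simp: card_3_iff)
  have F: "card (fst ` T) = (if fst a = fst b then if fst b = fst c then 1 else 2
      else if fst a = fst c \<or> fst b = fst c then 2 else 3)"
    and S: "card (snd ` T) = (if snd a = snd b then if snd b = snd c then 1 else 2
      else if snd a = snd c \<or> snd b = snd c then 2 else 3)"
    unfolding T image_insert image_empty by (rule card_insert3)+
  \<comment> \<open>Every pattern of the six possible equalities is either contradictory, by
    transitivity or because two points would coincide, or is put into normal form by one of the six
    orderings.\<close>
  have "C a b c \<or> C a c b \<or> C b a c \<or> C b c a \<or> C c a b \<or> C c b a"
  proof (cases "fst a = fst b"; cases "fst b = fst c"; cases "fst a = fst c";
        cases "snd a = snd b"; cases "snd b = snd c"; cases "snd a = snd c")
  qed (use d F S in \<open>simp_all add: C_def shape_def prod_eq_iff\<close>)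
  then obtain p0 p1 p2 where "C p0 p1 p2" "{p0, p1, p2} = T" unfolding T by blast
  then show ?thesis
    by (intro that[of "\<lambda>i. if i = 0 then p0 else if i = 1 then p1 else p2"])
       (auto simp: C_def numeral_3_eq_3 lessThan_Suc)
qed

lemma pair_normal_form:
  assumes "card T = 2"
  obtains p where "T = p ` {..<2::nat}"
    "fst (p 0) = fst (p 1) \<longleftrightarrow> card (fst ` T) = 1"
    "snd (p 0) = snd (p 1) \<longleftrightarrow> card (snd ` T) = 1"
proof -
  obtain a b where "T = {a, b}" "a \<noteq> b" using assms by (auto simp: card_2_iff)
  then show ?thesis
    by (intro that[of "\<lambda>i. if i = 0 then a else b"])
       (auto simp: numeral_2_eq_2 lessThan_Suc card_insert_if)
qed

text \<open>In normal form the coincidences of rows and of columns depend on the shape only, so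
  \<open>T\<close> and \<open>T'\<close> can be enumerated with the same pattern. The row and column
  permutations are then found independently of each other.\<close>

lemma same_shape_transitive:
  assumes "finite X" "finite Y" "T \<subseteq> X \<times> Y" "T' \<subseteq> X \<times> Y"
    and card: "card T = card T'" "card T = 2 \<or> card T = 3"
    and shape: "shape T = shape T'"
  obtains g h where "g permutes X" "h permutes Y" "map_prod g h ` T = T'"
proof -
  have "\<exists>n::nat. \<exists>p q. T = p ` {..<n} \<and> T' = q ` {..<n} \<and>
    (\<forall>i<n. \<forall>j<n. (fst (p i) = fst (p j) \<longleftrightarrow> fst (q i) = fst (q j)) \<and>
                 (snd (p i) = snd (p j) \<longleftrightarrow> snd (q i) = snd (q j)))"
    using card(2)
  proof
    assume T: "card T = 2"
    with card have T': "card T' = 2" by simp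
    obtain p where p: "T = p ` {..<2::nat}"
      "fst (p 0) = fst (p 1) \<longleftrightarrow> card (fst ` T) = 1"
      "snd (p 0) = snd (p 1) \<longleftrightarrow> card (snd ` T) = 1" by (rule pair_normal_form[OF T])
    obtain q where q: "T' = q ` {..<2::nat}"
      "fst (q 0) = fst (q 1) \<longleftrightarrow> card (fst ` T') = 1"
      "snd (q 0) = snd (q 1) \<longleftrightarrow> card (snd ` T') = 1" by (rule pair_normal_form[OF T'])
    have "\<forall>i<2. \<forall>j<2. (fst (p i) = fst (p j) \<longleftrightarrow> fst (q i) = fst (q j)) \<and>
                 (snd (p i) = snd (p j) \<longleftrightarrow> snd (q i) = snd (q j))"
      using p(2-) q(2-) shape
      by (auto simp: shape_def less_Suc_eq numeral_2_eq_2 eq_commute[of "fst (p (Suc 0))"]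
        eq_commute[of "snd (p (Suc 0))"] eq_commute[of "fst (q (Suc 0))"]
        eq_commute[of "snd (q (Suc 0))"])
    with p(1) q(1) show ?thesis by blast
  next
    assume T: "card T = 3"
    with card have T': "card T' = 3" by simp
    obtain p where p: "T = p ` {..<3::nat}"
      "fst (p 0) = fst (p 1) \<longleftrightarrow> card (fst ` T) \<le> 2"
      "fst (p 0) = fst (p 2) \<longleftrightarrow> card (fst ` T) = 1"
      "fst (p 1) = fst (p 2) \<longleftrightarrow> card (fst ` T) = 1"
      "snd (p 1) = snd (p 2) \<longleftrightarrow> card (snd ` T) = 1 \<or> shape T = (2, 2)"
      "snd (p 0) = snd (p 1) \<longleftrightarrow> card (snd ` T) = 1 \<or> shape T = (3, 2)"
      "snd (p 0) = snd (p 2) \<longleftrightarrow> card (snd ` T) = 1"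
      by (rule triple_normal_form[OF T])
    obtain q where q: "T' = q ` {..<3::nat}"
      "fst (q 0) = fst (q 1) \<longleftrightarrow> card (fst ` T') \<le> 2"
      "fst (q 0) = fst (q 2) \<longleftrightarrow> card (fst ` T') = 1"
      "fst (q 1) = fst (q 2) \<longleftrightarrow> card (fst ` T') = 1"
      "snd (q 1) = snd (q 2) \<longleftrightarrow> card (snd ` T') = 1 \<or> shape T' = (2, 2)"
      "snd (q 0) = snd (q 1) \<longleftrightarrow> card (snd ` T') = 1 \<or> shape T' = (3, 2)"
      "snd (q 0) = snd (q 2) \<longleftrightarrow> card (snd ` T') = 1"
      by (rule triple_normal_form[OF T'])
    have sh: "card (fst ` T) = card (fst ` T')" "card (snd ` T) = card (snd ` T')"
      using shape by (auto simp: shape_def)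
    \<comment> \<open>Rewriting by the normal forms turns each side into the same condition on the
      common shape.\<close>
    have pq: "fst (p 0) = fst (p 1) \<longleftrightarrow> fst (q 0) = fst (q 1)"
      "fst (p 0) = fst (p 2) \<longleftrightarrow> fst (q 0) = fst (q 2)"
      "fst (p 1) = fst (p 2) \<longleftrightarrow> fst (q 1) = fst (q 2)"
      "snd (p 0) = snd (p 1) \<longleftrightarrow> snd (q 0) = snd (q 1)"
      "snd (p 0) = snd (p 2) \<longleftrightarrow> snd (q 0) = snd (q 2)"
      "snd (p 1) = snd (p 2) \<longleftrightarrow> snd (q 1) = snd (q 2)"
      unfolding p(2-) q(2-) sh shape by (rule refl)+
    have lt3: "(\<forall>i<3. P i) \<longleftrightarrow> P 0 \<and> P 1 \<and> P 2" for P :: "nat \<Rightarrow> bool"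
      by (auto simp: numeral_3_eq_3 numeral_2_eq_2 less_Suc_eq)
    have "\<forall>i<3. \<forall>j<3. (fst (p i) = fst (p j) \<longleftrightarrow> fst (q i) = fst (q j)) \<and>
                 (snd (p i) = snd (p j) \<longleftrightarrow> snd (q i) = snd (q j))"
      unfolding lt3 using pq by (simp add: eq_sym_conv)
    with p(1) q(1) show ?thesis by blast
  qed
  then obtain n :: nat and p q where T: "T = p ` {..<n}" and T': "T' = q ` {..<n}"
    and pat: "\<And>i j. i < n \<Longrightarrow> j < n \<Longrightarrow> fst (p i) = fst (p j) \<longleftrightarrow> fst (q i) = fst (q j)"
      "\<And>i j. i < n \<Longrightarrow> j < n \<Longrightarrow> snd (p i) = snd (p j) \<longleftrightarrow> snd (q i) = snd (q j)"
    by blast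
  have sub: "(\<lambda>i. fst (p i)) ` {..<n} \<subseteq> X" "(\<lambda>i. fst (q i)) ` {..<n} \<subseteq> X"
    "(\<lambda>i. snd (p i)) ` {..<n} \<subseteq> Y" "(\<lambda>i. snd (q i)) ` {..<n} \<subseteq> Y"
    using assms(3,4) T T' by fastforce+
  obtain g where g: "g permutes X" "\<And>i. i \<in> {..<n} \<Longrightarrow> g (fst (p i)) = fst (q i)"
    by (rule permutation_of_same_equality_pattern[OF \<open>finite X\<close> sub(1,2)]) (use pat in auto)
  obtain h where h: "h permutes Y" "\<And>i. i \<in> {..<n} \<Longrightarrow> h (snd (p i)) = snd (q i)"
    by (rule permutation_of_same_equality_pattern[OF \<open>finite Y\<close> sub(3,4)]) (use pat in auto)
  have "map_prod g h (p i) = q i" if "i < n" for i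
    using g(2) h(2) that by (simp add: prod_eq_iff)
  then have "map_prod g h ` T = T'" unfolding T T' by (simp add: image_image)
  then show ?thesis using that g(1) h(1) by blast
qed

section \<open>Counting pairs and triples by shape\<close>

text \<open>Such a set lies in exactly one fibre of \<open>f\<close>. The assumption
  \<open>0 < t\<close> excludes the empty set, which lies in every fibre. The map is
  \<open>fst\<close> or \<open>snd\<close> for points, and the end on a chosen side for
  edges.\<close>

lemma card_constant_subsets:
  assumes "finite B" "finite A" "f ` B \<subseteq> A" "0 < t"
  shows "card {T. T \<subseteq> B \<and> card T = t \<and> card (f ` T) = 1}
    = (\<Sum>a\<in>A. card {p \<in> B. f p = a} choose t)"
proof -
  have "{T. T \<subseteq> B \<and> card T = t \<and> card (f ` T) = 1}
    = (\<Union>a\<in>A. {T. T \<subseteq> {p \<in> B. f p = a} \<and> card T = t})" (is "?L = ?R")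
  proof
    show "?L \<subseteq> ?R"
    proof
      fix T assume T: "T \<in> ?L"
      then obtain a where "f ` T = {a}" by (auto simp: card_1_singleton_iff)
      then have "a \<in> A" "T \<subseteq> {p \<in> B. f p = a}" using T \<open>f ` B \<subseteq> A\<close> by auto
      then show "T \<in> ?R" using T by blast
    qed
    show "?R \<subseteq> ?L"
    proof
      fix T assume "T \<in> ?R"
      then obtain a where a: "T \<subseteq> {p \<in> B. f p = a}" "card T = t" by blast
      then have "T \<noteq> {}" using \<open>0 < t\<close> by auto
      then have "f ` T = {a}" using a by auto
      then show "T \<in> ?L" using a by auto
    qed
  qed
  also have "card \<dots> = (\<Sum>a\<in>A. card {T. T \<subseteq> {p \<in> B. f p = a} \<and> card T = t})"
  proof (rule card_UN_disjoint)
    show "\<forall>i\<in>A. \<forall>j\<in>A. i \<noteq> j \<longrightarrow>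
      {T. T \<subseteq> {p \<in> B. f p = i} \<and> card T = t} \<inter> {T. T \<subseteq> {p \<in> B. f p = j} \<and> card T = t} = {}"
    proof (intro ballI impI)
      fix i j assume "i \<in> A" "j \<in> A" "i \<noteq> j"
      show "{T. T \<subseteq> {p \<in> B. f p = i} \<and> card T = t}
        \<inter> {T. T \<subseteq> {p \<in> B. f p = j} \<and> card T = t} = {}"
      proof (rule equals0I)
        fix T assume "T \<in> {T. T \<subseteq> {p \<in> B. f p = i} \<and> card T = t}
          \<inter> {T. T \<subseteq> {p \<in> B. f p = j} \<and> card T = t}"
        then have "T \<subseteq> {p \<in> B. f p = i}" "T \<subseteq> {p \<in> B. f p = j}" "card T = t" by simp_all
        moreover from this \<open>0 < t\<close> obtain p where "p \<in> T" by fastforce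
        ultimately show False using \<open>i \<noteq> j\<close> by blast
      qed
    qed
  qed (use assms in auto)
  also have "\<dots> = (\<Sum>a\<in>A. card {p \<in> B. f p = a} choose t)"
    using \<open>finite B\<close> by (intro sum.cong refl n_subsets) simp
  finally show ?thesis .
qed

text \<open>Agreement of \<open>f\<close> on two of the three pairs forces agreement on the third,
  so two constant pairs never occur.\<close>

lemma card_constant_pairs_in_triple:
  assumes "card T = 3"
  shows "card {S. S \<subseteq> T \<and> card S = 2 \<and> card (f ` S) = 1}
    = (if card (f ` T) = 1 then 3 else if card (f ` T) = 2 then 1 else 0)"
proof -
  obtain a b c where T: "T = {a, b, c}" and d: "a \<noteq> b" "a \<noteq> c" "b \<noteq> c"
    using assms by (auto simp: card_3_iff)
  have "{S. S \<subseteq> T \<and> card S = 2 \<and> card (f ` S) = 1} =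
    (if f a = f b then {{a, b}} else {}) \<union> (if f a = f c then {{a, c}} else {})
    \<union> (if f b = f c then {{b, c}} else {})" (is "?L = ?R")
  proof
    show "?L \<subseteq> ?R"
    proof
      fix S assume S: "S \<in> ?L"
      then obtain p q where pq: "S = {p, q}" "p \<noteq> q" by (auto simp: card_2_iff)
      have "p \<in> T" "q \<in> T" "f p = f q"
        using S unfolding pq by (auto simp: card_1_singleton_iff)
      moreover have "{b, a} = {a, b}" "{c, a} = {a, c}" "{c, b} = {b, c}" by auto
      ultimately show "S \<in> ?R" using pq unfolding T by (elim insertE) simp_all
    qed
    show "?R \<subseteq> ?L" unfolding T using d by (auto split: if_splits)
  qed
  moreover have "card (f ` T) = (if f a = f b then if f b = f c then 1 else 2
      else if f a = f c \<or> f b = f c then 2 else 3)"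
    unfolding T image_insert image_empty by (rule card_insert3)
  ultimately show ?thesis
    using d by (auto simp: doubleton_eq_iff card_insert_if)
qed

text \<open>Double counting of \<open>S \<subseteq> T\<close> with \<open>S\<close> a constant pair
  and \<open>T\<close> a triple: each pair extends by any of the remaining points. The truncated
  subtraction is harmless, as a set with fewer than two elements has no pairs.\<close>

lemma card_constant_pairs_extension:
  assumes "finite B"
  shows "card {S. S \<subseteq> B \<and> card S = 2 \<and> card (f ` S) = 1} * (card B - 2)
    = 3 * card {T. T \<subseteq> B \<and> card T = 3 \<and> card (f ` T) = 1}
      + card {T. T \<subseteq> B \<and> card T = 3 \<and> card (f ` T) = 2}"
proof -
  let ?S = "{S. S \<subseteq> B \<and> card S = 2 \<and> card (f ` S) = 1}"
  let ?T = "{T. T \<subseteq> B \<and> card T = 3}"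
  have fin: "finite ?S" "finite ?T" using assms by simp_all
  have ext: "card {T \<in> ?T. S \<subseteq> T} = card B - 2" if S: "S \<in> ?S" for S
  proof -
    have fS: "finite S" "S \<subseteq> B" "card S = 2" using S assms finite_subset by auto
    have "bij_betw (\<lambda>x. insert x S) (B - S) {T \<in> ?T. S \<subseteq> T}"
    proof (rule bij_betwI')
      fix x y assume "x \<in> B - S" "y \<in> B - S"
      then show "(insert x S = insert y S) = (x = y)" by blast
    next
      fix x assume "x \<in> B - S"
      then show "insert x S \<in> {T \<in> ?T. S \<subseteq> T}" using fS by auto
    next
      fix T assume T: "T \<in> {T \<in> ?T. S \<subseteq> T}"
      then have "card (T - S) = 1" using fS by (simp add: card_Diff_subset)
      then obtain x where "T - S = {x}" by (auto simp: card_1_singleton_iff)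
      then show "\<exists>x\<in>B - S. T = insert x S" using T by (intro bexI[of _ x]) auto
    qed
    then have "card {T \<in> ?T. S \<subseteq> T} = card (B - S)" by (simp add: bij_betw_same_card)
    then show ?thesis using fS by (simp add: card_Diff_subset)
  qed
  have inner: "card {S \<in> ?S. S \<subseteq> T}
    = (if card (f ` T) = 1 then 3 else 0) + (if card (f ` T) = 2 then 1 else 0)"
    if "T \<in> ?T" for T
  proof -
    have "{S \<in> ?S. S \<subseteq> T} = {S. S \<subseteq> T \<and> card S = 2 \<and> card (f ` S) = 1}" using that by auto
    then show ?thesis using card_constant_pairs_in_triple[of T f] that by simp
  qed
  have "card ?S * (card B - 2) = (\<Sum>S\<in>?S. card B - 2)" by simp
  also have "\<dots> = (\<Sum>S\<in>?S. card {T \<in> ?T. S \<subseteq> T})"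
    by (rule sum.cong[OF refl ext[symmetric]])
  also have "\<dots> = (\<Sum>T\<in>?T. card {S \<in> ?S. S \<subseteq> T})"
    using fin by (simp only: card_eq_sum) (rule sum.swap_restrict)
  also have "\<dots> = (\<Sum>T\<in>?T. (if card (f ` T) = 1 then 3 else 0) + (if card (f ` T) = 2 then 1 else 0))"
    by (rule sum.cong[OF refl inner])
  also have "\<dots> = (\<Sum>T\<in>{T \<in> ?T. card (f ` T) = 1}. 3) + (\<Sum>T\<in>{T \<in> ?T. card (f ` T) = 2}. 1)"
    unfolding sum.distrib sum.inter_filter[OF fin(2)] ..
  also have "\<dots> = 3 * card {T \<in> ?T. card (f ` T) = 1} + card {T \<in> ?T. card (f ` T) = 2}"
    by simp
  finally show ?thesis by (simp add: conj_assoc)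
qed

text \<open>Two rows and two columns cut out four cells, and a triple of this shape omits exactly
  one of them; hence the factor 4.\<close>

lemma card_triples_shape_2_2:
  assumes "finite X" "finite Y"
  shows "card {T. T \<subseteq> X \<times> Y \<and> card T = 3 \<and> shape T = (2, 2)}
    = 4 * (card X choose 2) * (card Y choose 2)"
proof -
  let ?I = "{A. A \<subseteq> X \<and> card A = 2} \<times> {A. A \<subseteq> Y \<and> card A = 2}"
  let ?F = "\<lambda>(A, A'). {T. T \<subseteq> A \<times> A' \<and> card T = 3}"
  \<comment> \<open>Three cells do not fit into a product with a side of size below 2 and the other
    of size at most 2. So the triple determines its rows and columns, which makes the union below
    disjoint.\<close>
  have full: "fst ` T = A \<and> snd ` T = A'"
    if "T \<subseteq> A \<times> A'" "card T = 3" "card A = 2" "card A' = 2" for T and A :: "'a set" and A' :: "'b set"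
  proof -
    have fin: "finite A" "finite A'" using that by (auto intro: card_ge_0_finite)
    have sub: "fst ` T \<subseteq> A" "snd ` T \<subseteq> A'" using that by auto
    then have le: "card (fst ` T) \<le> 2" "card (snd ` T) \<le> 2"
      using card_mono[OF fin(1)] card_mono[OF fin(2)] that by fastforce+
    have "T \<subseteq> fst ` T \<times> snd ` T" by force
    then have "3 \<le> card (fst ` T) * card (snd ` T)"
      using card_mono[of "fst ` T \<times> snd ` T" T] sub fin that
      by (simp add: card_cartesian_product finite_subset)
    moreover have "card (fst ` T) \<in> {0, 1, 2}" "card (snd ` T) \<in> {0, 1, 2}" using le by auto
    ultimately have "card (fst ` T) = 2" "card (snd ` T) = 2" by auto
    then show ?thesis using sub fin that by (simp add: card_subset_eq)
  qed
  have "{T. T \<subseteq> X \<times> Y \<and> card T = 3 \<and> shape T = (2, 2)} = (\<Union>i\<in>?I. ?F i)" (is "?L = ?R")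
  proof
    show "?L \<subseteq> ?R"
    proof
      fix T assume T: "T \<in> ?L"
      have "T \<subseteq> fst ` T \<times> snd ` T" by force
      then have "(fst ` T, snd ` T) \<in> ?I" "T \<in> ?F (fst ` T, snd ` T)"
        using T by (auto simp: shape_def)
      then show "T \<in> ?R" by blast
    qed
    show "?R \<subseteq> ?L"
    proof
      fix T assume "T \<in> ?R"
      then obtain A A' where A: "A \<subseteq> X" "card A = 2" "A' \<subseteq> Y" "card A' = 2"
        "T \<subseteq> A \<times> A'" "card T = 3" by auto
      then have "fst ` T = A" "snd ` T = A'" using full by blast+
      then show "T \<in> ?L" using A by (auto simp: shape_def)
    qed
  qed
  moreover have "card (\<Union>i\<in>?I. ?F i) = (\<Sum>i\<in>?I. card (?F i))"
  proof (rule card_UN_disjoint)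
    show "finite ?I" using assms by simp
    show "\<forall>i\<in>?I. finite (?F i)"
    proof
      fix i assume "i \<in> ?I"
      then have "finite (fst i)" "finite (snd i)" by (auto intro: card_ge_0_finite)
      then show "finite (?F i)" by (simp add: case_prod_beta)
    qed
    show "\<forall>i\<in>?I. \<forall>j\<in>?I. i \<noteq> j \<longrightarrow> ?F i \<inter> ?F j = {}"
    proof (intro ballI impI equals0I)
      fix i j T assume ij: "i \<in> ?I" "j \<in> ?I" "i \<noteq> j" and T: "T \<in> ?F i \<inter> ?F j"
      obtain A A' where i: "i = (A, A')" by (cases i)
      obtain C C' where j: "j = (C, C')" by (cases j)
      have "fst ` T = A \<and> snd ` T = A'" using ij T unfolding i by (intro full) auto
      moreover have "fst ` T = C \<and> snd ` T = C'" using ij T unfolding j by (intro full) auto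
      ultimately show False using ij i j by simp
    qed
  qed
  moreover have "card (?F i) = 4" if "i \<in> ?I" for i
  proof -
    obtain A A' where i: "i = (A, A')" by (cases i)
    with that have A: "card A = 2" "card A' = 2" by auto
    then have "finite A" "finite A'" by (auto intro: card_ge_0_finite)
    then have "finite (A \<times> A')" by simp
    from n_subsets[OF this, of 3] show ?thesis
      by (simp add: i A card_cartesian_product numeral_eq_Suc)
  qed
  ultimately have "card ?L = (\<Sum>i\<in>?I. 4)" by simp
  also have "\<dots> = 4 * (card X choose 2) * (card Y choose 2)"
    using n_subsets[OF \<open>finite X\<close>, of 2] n_subsets[OF \<open>finite Y\<close>, of 2]
    by (simp add: card_cartesian_product)
  finally show ?thesis .
qed

section \<open>Paths and claws\<close>

lemma path_edges_3: "path_edges [a, b, c] = {{a, b}, {b, c}}"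
proof -
  have "{i. Suc i < length [a, b, c]} = {0, 1}" by auto
  then have "path_edges [a, b, c] = (\<lambda>i. {[a, b, c] ! i, [a, b, c] ! Suc i}) ` {0, 1}"
    unfolding path_edges_def setcompr_eq_image by simp
  then show ?thesis by simp
qed

lemma path_edges_4: "path_edges [a, b, c, d] = {{a, b}, {b, c}, {c, d}}"
proof -
  have "{i. Suc i < length [a, b, c, d]} = {0, 1, 2}" by auto
  then have "path_edges [a, b, c, d] = (\<lambda>i. {[a, b, c, d] ! i, [a, b, c, d] ! Suc i}) ` {0, 1, 2}"
    unfolding path_edges_def setcompr_eq_image by simp
  then show ?thesis by simp
qed

lemma u_paths_2:
  "S \<in> u_paths 2 \<Delta> \<longleftrightarrow> S \<subseteq> \<Delta> \<and> (\<exists>a b c. distinct [a, b, c] \<and> S = {{a, b}, {b, c}})"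
proof -
  have "(\<exists>vs. distinct vs \<and> length vs = 2 + 1 \<and> S = path_edges vs) \<longleftrightarrow>
    (\<exists>a b c. distinct [a, b, c] \<and> S = {{a, b}, {b, c}})" (is "?l = ?r")
  proof
    assume ?l
    then obtain vs where "distinct vs" "length vs = Suc (Suc (Suc 0))" "S = path_edges vs" by auto
    then obtain a b c where "vs = [a, b, c]" by (auto simp: length_Suc_conv)
    then show ?r using \<open>distinct vs\<close> \<open>S = path_edges vs\<close> path_edges_3 by metis
  next
    assume ?r
    then obtain a b c where "distinct [a, b, c]" "S = path_edges [a, b, c]"
      by (auto simp: path_edges_3)
    then show ?l by (intro exI[of _ "[a, b, c]"]) simp
  qed
  then show ?thesis by (simp add: u_paths_def)
qed

lemma u_paths_3:
  "S \<in> u_paths 3 \<Delta> \<longleftrightarrow>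
    S \<subseteq> \<Delta> \<and> (\<exists>a b c d. distinct [a, b, c, d] \<and> S = {{a, b}, {b, c}, {c, d}})"
proof -
  have "(\<exists>vs. distinct vs \<and> length vs = 3 + 1 \<and> S = path_edges vs) \<longleftrightarrow>
    (\<exists>a b c d. distinct [a, b, c, d] \<and> S = {{a, b}, {b, c}, {c, d}})" (is "?l = ?r")
  proof
    assume ?l
    then obtain vs where "distinct vs" "length vs = Suc (Suc (Suc (Suc 0)))" "S = path_edges vs"
      by auto
    then obtain a b c d where "vs = [a, b, c, d]" by (auto simp: length_Suc_conv)
    then show ?r using \<open>distinct vs\<close> \<open>S = path_edges vs\<close> path_edges_4 by metis
  next
    assume ?r
    then obtain a b c d where "distinct [a, b, c, d]" "S = path_edges [a, b, c, d]"
      by (auto simp: path_edges_4)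
    then show ?l by (intro exI[of _ "[a, b, c, d]"]) simp
  qed
  then show ?thesis by (simp add: u_paths_def)
qed

text \<open>
  Only one side of the bipartition is singled out, so that both types of 2-paths and claws are
  instances.
\<close>

locale one_sided =
  fixes \<Delta> :: "'v set set" and Z :: "'v set"
  assumes finite_edges: "finite \<Delta>" and finite_side: "finite Z"
    and edge: "e \<in> \<Delta> \<Longrightarrow> \<exists>z\<in>Z. \<exists>w. w \<notin> Z \<and> e = {z, w}"
begin

text \<open>The description is unique for edges of \<open>\<Delta>\<close>, which meet
  \<open>Z\<close> in one vertex. A set of edges is a star centred in \<open>Z\<close> exactly when
  it is nonempty and \<open>end_in\<close> is constant on it, so 2-paths and claws become constant
  subsets of size 2 and 3.\<close>

definition end_in :: "'v set \<Rightarrow> 'v" where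
  "end_in e = (THE z. z \<in> Z \<and> z \<in> e)"

lemma end_in_eq_iff:
  assumes "e \<in> \<Delta>" "z \<in> Z"
  shows "end_in e = z \<longleftrightarrow> z \<in> e"
proof -
  obtain z' w where e: "z' \<in> Z" "w \<notin> Z" "e = {z', w}" using edge[OF \<open>e \<in> \<Delta>\<close>] by blast
  then have "end_in e = z'" unfolding end_in_def by (intro the_equality) auto
  then show ?thesis using e \<open>z \<in> Z\<close> by auto
qed

lemma edge_end:
  assumes "e \<in> \<Delta>"
  obtains w where "w \<notin> Z" "end_in e \<in> Z" "e = {end_in e, w}"
proof -
  obtain z w where e: "z \<in> Z" "w \<notin> Z" "e = {z, w}" using edge[OF assms] by blast
  then have "end_in e = z" using end_in_eq_iff[OF assms] by simp
  then show ?thesis using that e by simp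
qed

lemma end_in_side: "end_in ` \<Delta> \<subseteq> Z"
  by (metis edge_end image_subsetI)

lemma sum_valency_choose:
  "0 < t \<Longrightarrow> card {S. S \<subseteq> \<Delta> \<and> card S = t \<and> card (end_in ` S) = 1}
    = (\<Sum>z\<in>Z. valency \<Delta> z choose t)"
  unfolding card_constant_subsets[OF finite_edges finite_side end_in_side] valency_def
  by (intro sum.cong refl) (simp add: end_in_eq_iff cong: conj_cong)

text \<open>Two different edges with the same end in \<open>Z\<close> have different other ends,
  both outside \<open>Z\<close>, so they always form a path with its middle in
  \<open>Z\<close>.\<close>

lemma two_paths_eq:
  "{S \<in> u_paths 2 \<Delta>. middle_vertex_in Z S}
    = {S. S \<subseteq> \<Delta> \<and> card S = 2 \<and> card (end_in ` S) = 1}" (is "?L = ?R")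
proof
  show "?L \<subseteq> ?R"
  proof
    fix S assume S: "S \<in> ?L"
    then obtain a b c where abc: "distinct [a, b, c]" "S = {{a, b}, {b, c}}" "b \<in> Z"
      by (auto simp: middle_vertex_in_def path_edges_3)
    have "S \<subseteq> \<Delta>" using S by (simp add: u_paths_2)
    then have "end_in ` S = {b}" using abc by (auto simp: end_in_eq_iff)
    moreover have "card S = 2" using abc by (auto simp: doubleton_eq_iff)
    ultimately show "S \<in> ?R" using \<open>S \<subseteq> \<Delta>\<close> by simp
  qed
  show "?R \<subseteq> ?L"
  proof
    fix S assume S: "S \<in> ?R"
    then obtain e e' where e: "S = {e, e'}" "e \<noteq> e'" by (auto simp: card_2_iff)
    with S have "end_in e = end_in e'" "e \<in> \<Delta>" "e' \<in> \<Delta>"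
      by (auto simp: card_1_singleton_iff)
    moreover from this obtain w w' where "end_in e \<in> Z" "w \<notin> Z" "e = {end_in e, w}"
      "w' \<notin> Z" "e' = {end_in e', w'}"
      using edge_end by metis
    ultimately obtain z w w' where z: "z \<in> Z" "w \<notin> Z" "w' \<notin> Z" "e = {z, w}" "e' = {z, w'}"
      by metis
    then have "distinct [w, z, w']" "S = {{w, z}, {z, w'}}" using e by auto
    then show "S \<in> ?L" using S \<open>z \<in> Z\<close>
      unfolding mem_Collect_eq u_paths_2 middle_vertex_in_def path_edges_3 by blast
  qed
qed

lemma card_two_paths:
  "card {S \<in> u_paths 2 \<Delta>. middle_vertex_in Z S} = (\<Sum>z\<in>Z. valency \<Delta> z choose 2)"
  unfolding two_paths_eq by (rule sum_valency_choose) simp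

lemma claws_eq:
  "three_claws_of_type Z \<Delta> = {S. S \<subseteq> \<Delta> \<and> card S = 3 \<and> card (end_in ` S) = 1}" (is "?L = ?R")
proof
  show "?L \<subseteq> ?R"
  proof
    fix S assume "S \<in> ?L"
    then obtain X Y z where S: "S \<subseteq> \<Delta>" "X \<inter> Y = {}" "card X = 1" "card Y = 3"
      "S = complete_bipartite X Y" and z: "z \<in> Z" "valency S z = 3"
      by (auto simp: three_claws_of_type_def three_claws_def)
    obtain v where X: "X = {v}" using S by (auto simp: card_1_singleton_iff)
    have Seq: "S = (\<lambda>y. {v, y}) ` Y" using S X by (auto simp: complete_bipartite_def)
    have "v \<notin> Y" using S X by simp
    then have "inj_on (\<lambda>y. {v, y}) Y" by (auto simp: inj_on_def doubleton_eq_iff)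
    then have "card S = 3" using S(4) Seq by (simp add: card_image)
    \<comment> \<open>The type of a claw is read off from a vertex of valency 3. A vertex other than
      the centre lies on at most one edge of the claw, so that vertex must be the centre.\<close>
    have "z = v"
    proof (rule ccontr)
      assume "z \<noteq> v"
      then have "{e \<in> S. z \<in> e} \<subseteq> {{v, z}}" using Seq by auto
      then have "valency S z \<le> 1" unfolding valency_def
        using card_mono[of "{{v, z}}" "{e \<in> S. z \<in> e}"] by simp
      then show False using z by simp
    qed
    then have "end_in e = z" if "e \<in> S" for e
      using that z S(1) Seq by (subst end_in_eq_iff) auto
    moreover have "S \<noteq> {}" using \<open>card S = 3\<close> by auto
    ultimately have "end_in ` S = {z}" by auto
    then show "S \<in> ?R" using \<open>card S = 3\<close> S by simp
  qed
  show "?R \<subseteq> ?L"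
  proof
    fix S assume S: "S \<in> ?R"
    then obtain z where z: "end_in ` S = {z}" by (auto simp: card_1_singleton_iff)
    have "end_in ` S \<subseteq> end_in ` \<Delta>" using S by (intro image_mono) simp
    then have "{z} \<subseteq> Z" unfolding z using end_in_side by (rule subset_trans)
    then have "z \<in> Z" by simp
    define Y where "Y = {w. w \<notin> Z \<and> {z, w} \<in> S}"
    have "S = (\<lambda>w. {z, w}) ` Y"
    proof
      show "S \<subseteq> (\<lambda>w. {z, w}) ` Y"
      proof
        fix e assume "e \<in> S"
        then have "e \<in> \<Delta>" "end_in e = z" using S z by auto
        then obtain w where "w \<notin> Z" "e = {z, w}" using edge_end[of e] by metis
        then show "e \<in> (\<lambda>w. {z, w}) ` Y" using \<open>e \<in> S\<close> by (simp add: Y_def)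
      qed
    qed (auto simp: Y_def)
    moreover have "z \<notin> Y" using \<open>z \<in> Z\<close> by (simp add: Y_def)
    moreover have "inj_on (\<lambda>w. {z, w}) Y"
      by (auto simp: inj_on_def doubleton_eq_iff)
    ultimately have "S = complete_bipartite {z} Y" "card Y = 3" "{z} \<inter> Y = {}"
      using S by (auto simp: complete_bipartite_def card_image)
    moreover have "{e \<in> S. z \<in> e} = S" using \<open>S = (\<lambda>w. {z, w}) ` Y\<close> by auto
    then have "valency S z = 3" using S by (simp add: valency_def)
    moreover have "card {z} = 1" by simp
    ultimately show "S \<in> ?L" using S \<open>z \<in> Z\<close>
      unfolding three_claws_of_type_def three_claws_def by blast
  qed
qed

lemma card_claws: "card (three_claws_of_type Z \<Delta>) = (\<Sum>z\<in>Z. valency \<Delta> z choose 3)"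
  unfolding claws_eq by (rule sum_valency_choose) simp

end

section \<open>The action on the points\<close>

definition edge_of :: "'v \<times> 'v \<Rightarrow> 'v set" where
  "edge_of p = {fst p, snd p}"

text \<open>\<open>K\<close> realised by functions on the whole product type, as
  \<open>perm_group\<close> demands bijections of the type; a permutation of one side fixes every
  vertex off that side.\<close>

definition point_perms :: "'v set \<Rightarrow> 'v set \<Rightarrow> ('v \<times> 'v \<Rightarrow> 'v \<times> 'v) set" where
  "point_perms X Y = (\<lambda>g. map_prod (fst g) (snd g)) ` sym_prod X Y"

text \<open>Faithfulness of the action: orders of \<open>K\<close> and of the stabiliser can be
  computed among the functions on points.\<close>

lemma inj_map_prod_pair: "inj (\<lambda>g :: ('a \<Rightarrow> 'a) \<times> ('b \<Rightarrow> 'b). map_prod (fst g) (snd g))"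
proof (rule injI)
  fix g h :: "('a \<Rightarrow> 'a) \<times> ('b \<Rightarrow> 'b)"
  assume *: "map_prod (fst g) (snd g) = map_prod (fst h) (snd h)"
  have "map_prod (fst g) (snd g) (a, b) = map_prod (fst h) (snd h) (a, b)" for a b
    using * by simp
  then show "g = h" by (simp add: prod_eq_iff fun_eq_iff)
qed

locale bipartite =
  fixes X Y :: "'v set" and \<Delta> :: "'v set set"
  assumes fin: "finite X" "finite Y"
    and disjoint: "X \<inter> Y = {}"
    and edges: "\<Delta> \<subseteq> complete_bipartite X Y"
begin

abbreviation B :: "('v \<times> 'v) set" where "B \<equiv> block X Y \<Delta>"

lemma not_both: "a \<in> X \<Longrightarrow> a \<in> Y \<Longrightarrow> False"
  using disjoint by blast

lemma B_subset: "B \<subseteq> X \<times> Y"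
  by (auto simp: block_def)

lemma finite_B: "finite B"
  using B_subset fin finite_subset by blast

lemma inj_on_edge_of: "inj_on edge_of (X \<times> Y)"
  by (auto simp: inj_on_def edge_of_def doubleton_eq_iff dest: not_both)

lemma edge_of_B: "edge_of ` B = \<Delta>"
proof
  show "edge_of ` B \<subseteq> \<Delta>" by (auto simp: block_def edge_of_def)
  show "\<Delta> \<subseteq> edge_of ` B"
  proof
    fix e assume e: "e \<in> \<Delta>"
    then obtain r c where "r \<in> X" "c \<in> Y" "e = {r, c}"
      using edges by (auto simp: complete_bipartite_def)
    then have "(r, c) \<in> B" "e = edge_of (r, c)" using e by (auto simp: block_def edge_of_def)
    then show "e \<in> edge_of ` B" by blast
  qed
qed

lemma card_B: "card B = card \<Delta>"
  using card_image[OF inj_on_subset[OF inj_on_edge_of B_subset]] by (simp add: edge_of_B)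

lemma finite_edges: "finite \<Delta>"
  using finite_B edge_of_B by (metis finite_imageI)

lemma block_edge_of:
  assumes "T \<subseteq> X \<times> Y"
  shows "block X Y (edge_of ` T) = T"
proof -
  have "(r, c) \<in> T" if "r \<in> X" "c \<in> Y" "{r, c} \<in> edge_of ` T" for r c
  proof -
    obtain p where "p \<in> T" "edge_of (r, c) = edge_of p"
      using \<open>{r, c} \<in> edge_of ` T\<close> by (auto simp: edge_of_def)
    moreover from this have "p \<in> X \<times> Y" using assms by blast
    ultimately show ?thesis using inj_onD[OF inj_on_edge_of] that by (metis SigmaI)
  qed
  moreover have "{r, c} \<in> edge_of ` T" if "(r, c) \<in> T" for r c
    using that by (force simp: edge_of_def)
  ultimately show ?thesis using assms by (auto simp: block_def)
qed

text \<open>Equivariance of the passage from points to edges. Together with injectivity of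
  \<open>edge_of\<close> it transfers both the stabiliser and the blocks from graphs to sets of
  points.\<close>

lemma graph_act_edge_of:
  assumes "T \<subseteq> X \<times> Y"
  shows "graph_act X g (edge_of ` T) = edge_of ` map_prod (fst g) (snd g) ` T"
proof -
  \<comment> \<open>\<open>vertex_act\<close> decides by membership in \<open>X\<close>, so
    disjointness of the sides is what makes the column vertex move by \<open>snd g\<close>.\<close>
  have "vertex_act X g ` edge_of p = edge_of (map_prod (fst g) (snd g) p)" if "p \<in> X \<times> Y" for p
  proof -
    have "fst p \<in> X" "snd p \<notin> X" using that not_both by auto
    then show ?thesis by (simp add: edge_of_def vertex_act_def insert_commute)
  qed
  then show ?thesis unfolding graph_act_def image_image using assms by (intro image_cong) auto
qed

lemma map_prod_subset:
  assumes "g \<in> sym_prod X Y" "T \<subseteq> X \<times> Y"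
  shows "map_prod (fst g) (snd g) ` T \<subseteq> X \<times> Y"
  using assms by (auto simp: sym_prod_def permutes_in_image dest!: subsetD)

sublocale perm_group "point_perms X Y"
proof
  show "finite (point_perms X Y)"
    using fin by (simp add: point_perms_def sym_prod_def finite_permutations)
  show "bij g" if "g \<in> point_perms X Y" for g
    using that by (auto simp: point_perms_def sym_prod_def bij_def permutes_inj permutes_surj
      intro!: prod.inj_map map_prod_surj)
  show "g \<circ> h \<in> point_perms X Y" if gh: "g \<in> point_perms X Y" "h \<in> point_perms X Y" for g h
  proof -
    obtain a b where g: "g = map_prod a b" "a permutes X" "b permutes Y"
      using gh(1) by (auto simp: point_perms_def sym_prod_def)
    obtain c d where h: "h = map_prod c d" "c permutes X" "d permutes Y"
      using gh(2) by (auto simp: point_perms_def sym_prod_def)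
    have "(a \<circ> c, b \<circ> d) \<in> sym_prod X Y"
      using g h by (simp add: sym_prod_def permutes_compose)
    then show ?thesis unfolding point_perms_def g h map_prod_compose by force
  qed
  show "inv g \<in> point_perms X Y" if gh: "g \<in> point_perms X Y" for g
  proof -
    obtain a b where g: "g = map_prod a b" "a permutes X" "b permutes Y"
      using gh by (auto simp: point_perms_def sym_prod_def)
    have "inv (map_prod a b) = map_prod (inv a) (inv b)"
      using g by (intro inv_equality) (auto simp: permutes_inverses)
    moreover have "(inv a, inv b) \<in> sym_prod X Y"
      using g by (simp add: sym_prod_def permutes_inv)
    ultimately show ?thesis unfolding point_perms_def g by force
  qed
  have "(id, id) \<in> sym_prod X Y" by (simp add: sym_prod_def permutes_id)
  then show "point_perms X Y \<noteq> {}" by (auto simp: point_perms_def)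
qed

lemma card_point_perms: "card (point_perms X Y) = fact (card X) * fact (card Y)"
proof -
  have "card (point_perms X Y) = card (sym_prod X Y)"
    unfolding point_perms_def by (rule card_image[OF inj_on_subset[OF inj_map_prod_pair]]) simp
  then show ?thesis
    using fin by (simp add: sym_prod_def card_cartesian_product card_permutations)
qed

lemma card_stabiliser: "card {g \<in> point_perms X Y. g ` B = B} = card (graph_stabiliser X Y \<Delta>)"
proof -
  have "graph_act X g \<Delta> = \<Delta> \<longleftrightarrow> map_prod (fst g) (snd g) ` B = B" if "g \<in> sym_prod X Y" for g
    using graph_act_edge_of[OF B_subset, of g] edge_of_B
      inj_on_image_eq_iff[OF inj_on_edge_of map_prod_subset[OF that B_subset] B_subset] by metis
  then have "graph_stabiliser X Y \<Delta> = {g \<in> sym_prod X Y. map_prod (fst g) (snd g) ` B = B}"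
    unfolding graph_stabiliser_def by blast
  then have "{g \<in> point_perms X Y. g ` B = B}
    = (\<lambda>g. map_prod (fst g) (snd g)) ` graph_stabiliser X Y \<Delta>"
    unfolding point_perms_def by blast
  then show ?thesis
    by (simp add: card_image[OF inj_on_subset[OF inj_map_prod_pair]])
qed

lemma design_of_eq: "design_of X Y \<Delta> = (X \<times> Y, (\<lambda>g. g ` B) ` point_perms X Y)"
proof -
  have "block X Y (graph_act X g \<Delta>) = map_prod (fst g) (snd g) ` B" if "g \<in> sym_prod X Y" for g
    using graph_act_edge_of[OF B_subset, of g] block_edge_of[OF map_prod_subset[OF that B_subset]]
    by (simp add: edge_of_B)
  then show ?thesis
    unfolding design_of_def point_perms_def setcompr_eq_image image_image
    by (auto intro!: image_cong)
qed

text \<open>The values 2 and 3 of \<open>t\<close> are those for which the shape is shown to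
  separate orbits. The product of factorials is the order of \<open>K\<close>.\<close>

lemma design_iff:
  assumes t: "t = 2 \<or> t = 3" "t \<le> card \<Delta>"
  defines "n \<equiv> \<lambda>A i. card {S. S \<subseteq> A \<and> card S = t \<and> shape S = i}"
  shows "is_t_design t (design_of X Y \<Delta>) \<longleftrightarrow>
      (\<forall>i. n B i * (card (X \<times> Y) choose t) = n (X \<times> Y) i * (card \<Delta> choose t))" (is ?A)
    and "is_t_design t (design_of X Y \<Delta>) \<Longrightarrow>
      \<exists>l. is_t_v_k_design t (card (X \<times> Y)) (card \<Delta>) l (design_of X Y \<Delta>) \<and>
        l * card (graph_stabiliser X Y \<Delta>) * (card (X \<times> Y) choose t)
          = fact (card X) * fact (card Y) * (card \<Delta> choose t)" (is "_ \<Longrightarrow> ?B")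
proof -
  have P: "g ` (X \<times> Y) = X \<times> Y" if g_in: "g \<in> point_perms X Y" for g
  proof -
    obtain a b where g: "g = map_prod a b" "a permutes X" "b permutes Y"
      using g_in by (auto simp: point_perms_def sym_prod_def)
    show ?thesis unfolding g(1)
      using permutes_image[OF g(2)] permutes_image[OF g(3)] by (rule map_prod_surj_on)
  qed
  have inv: "shape (g ` S) = shape S" if g_in: "g \<in> point_perms X Y" "S \<subseteq> X \<times> Y" for g S
  proof -
    obtain a b where g: "g = map_prod a b" "a permutes X" "b permutes Y"
      using g_in by (auto simp: point_perms_def sym_prod_def)
    have "fst ` g ` S = a ` fst ` S" "snd ` g ` S = b ` snd ` S"
      unfolding g image_image by simp_all
    then show ?thesis
      by (simp add: shape_def card_image inj_on_subset[OF permutes_inj[OF g(2)]]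
        inj_on_subset[OF permutes_inj[OF g(3)]])
  qed
  have trans: "\<exists>g\<in>point_perms X Y. g ` S = S'"
    if S: "S \<subseteq> X \<times> Y" "S' \<subseteq> X \<times> Y" "card S = t" "card S' = t" "shape S = shape S'" for S S'
  proof -
    have c: "card S = card S'" "card S = 2 \<or> card S = 3" using S t by auto
    obtain g h where "g permutes X" "h permutes Y" "map_prod g h ` S = S'"
      by (rule same_shape_transitive[OF fin S(1,2) c S(5)])
    moreover from this have "map_prod g h \<in> point_perms X Y"
      unfolding point_perms_def sym_prod_def by force
    ultimately show ?thesis by blast
  qed
  have pre: "finite (X \<times> Y)" "0 < t" "t \<le> card B" using fin t card_B by auto
  note main = t_design_iff[where ty = shape, OF pre(1) B_subset pre(2,3) P inv trans]
  show ?A using main(1) unfolding design_of_eq n_def card_B by blast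
  show ?B if "is_t_design t (design_of X Y \<Delta>)"
    using main(2) that unfolding design_of_eq card_B card_point_perms card_stabiliser
    by blast
qed

lemma card_three_paths:
  "card (u_paths 3 \<Delta>) = card {T. T \<subseteq> B \<and> card T = 3 \<and> shape T = (2, 2)}"
proof -
  let ?N = "{T. T \<subseteq> B \<and> card T = 3 \<and> shape T = (2, 2)}"
  have inX: "(a, b) \<in> B" if "{a, b} \<in> \<Delta>" "a \<in> X" for a b
  proof -
    have "{a, b} \<in> edge_of ` B" using that(1) edge_of_B by simp
    then obtain r c where rc: "{a, b} = {r, c}" "(r, c) \<in> B" by (auto simp: edge_of_def)
    then have "c \<in> Y" using B_subset by auto
    then have "a = r" "b = c" using rc(1) that(2) not_both by (auto simp: doubleton_eq_iff)
    then show ?thesis using rc(2) by simp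
  qed
  have side: "a \<in> X \<and> b \<in> Y \<or> b \<in> X \<and> a \<in> Y" if "{a, b} \<in> \<Delta>" for a b
    using that edges by (auto simp: complete_bipartite_def doubleton_eq_iff)
  have "u_paths 3 \<Delta> = image edge_of ` ?N"
  proof
    show "u_paths 3 \<Delta> \<subseteq> image edge_of ` ?N"
    proof
      fix S assume "S \<in> u_paths 3 \<Delta>"
      then obtain a b c d where S: "S \<subseteq> \<Delta>" "distinct [a, b, c, d]"
        "S = {{a, b}, {b, c}, {c, d}}" by (auto simp: u_paths_3)
      \<comment> \<open>For \<open>b\<close> in \<open>X\<close> the vertex \<open>d\<close> is in
        \<open>X\<close> as well, and the edges occupy rows \<open>b\<close>, \<open>d\<close> and
        columns \<open>a\<close>, \<open>c\<close>. If \<open>b\<close> is a column, the path is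
        read backwards.\<close>
      have *: "image edge_of {(b, a), (b, c), (d, c)} \<in> image edge_of ` ?N"
        if "{a, b} \<in> \<Delta>" "{b, c} \<in> \<Delta>" "{c, d} \<in> \<Delta>" "distinct [a, b, c, d]" "b \<in> X"
        for a b c d
      proof -
        have "d \<in> X" using side[of b c] side[of c d] that not_both by blast
        then have "{(b, a), (b, c), (d, c)} \<subseteq> B"
          using that inX by (auto simp: insert_commute)
        then show ?thesis using that(4) by (intro imageI) (simp add: shape_def)
      qed
      show "S \<in> image edge_of ` ?N"
      proof (cases "b \<in> X")
        case True
        then show ?thesis using *[of a b c d] S by (auto simp: edge_of_def insert_commute)
      next
        case False
        then have "c \<in> X" using side[of b c] S by auto
        then show ?thesis using *[of d c b a] S by (auto simp: edge_of_def insert_commute)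
      qed
    qed
    show "image edge_of ` ?N \<subseteq> u_paths 3 \<Delta>"
    proof
      fix S assume "S \<in> image edge_of ` ?N"
      then obtain T where T: "T \<subseteq> B" "card T = 3" "shape T = (2, 2)" "S = edge_of ` T" by auto
      have c: "card (fst ` T) = 2" "card (snd ` T) = 2" using T(3) by (auto simp: shape_def)
      obtain p where p: "T = p ` {..<3::nat}"
        "fst (p 0) = fst (p 1) \<longleftrightarrow> card (fst ` T) \<le> 2"
        "fst (p 0) = fst (p 2) \<longleftrightarrow> card (fst ` T) = 1"
        "fst (p 1) = fst (p 2) \<longleftrightarrow> card (fst ` T) = 1"
        "snd (p 1) = snd (p 2) \<longleftrightarrow> card (snd ` T) = 1 \<or> shape T = (2, 2)"
        "snd (p 0) = snd (p 1) \<longleftrightarrow> card (snd ` T) = 1 \<or> shape T = (3, 2)"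
        "snd (p 0) = snd (p 2) \<longleftrightarrow> card (snd ` T) = 1"
        by (rule triple_normal_form[OF T(2)])
      have Teq: "T = {p 0, p 1, p 2}" unfolding p(1) by (auto simp: numeral_eq_Suc lessThan_Suc)
      then have in_XY: "fst (p i) \<in> X" "snd (p i) \<in> Y" if "i \<in> {0, 1, 2}" for i
        using T(1) B_subset that by auto
      \<comment> \<open>The normal form puts the middle edge second: \<open>p 1\<close> shares its
        row with \<open>p 0\<close> and its column with \<open>p 2\<close>, which dictates the order
        of the vertices.\<close>
      let ?a = "snd (p 0)" and ?b = "fst (p 0)" and ?c = "snd (p 1)" and ?d = "fst (p 2)"
      have eq: "fst (p 1) = ?b" "snd (p 2) = ?c" using p(2-) c T(3) by auto
      have "?a \<noteq> ?c" "?b \<noteq> ?d" using p(2-) c T(3) by auto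
      moreover have "?a \<in> Y" "?b \<in> X" "?c \<in> Y" "?d \<in> X" using in_XY by simp_all
      ultimately have "distinct [?a, ?b, ?c, ?d]" using not_both by auto
      moreover have "S = {{?a, ?b}, {?b, ?c}, {?c, ?d}}"
        unfolding T(4) Teq image_insert image_empty edge_of_def eq by (simp add: insert_commute)
      moreover have "S \<subseteq> \<Delta>" using T(1,4) edge_of_B by blast
      ultimately show "S \<in> u_paths 3 \<Delta>" unfolding u_paths_3 by blast
    qed
  qed
  moreover have "inj_on (image edge_of) ?N"
    by (rule inj_on_subset[OF inj_on_image_Pow[OF inj_on_edge_of]]) (use B_subset in auto)
  ultimately show ?thesis by (simp add: card_image)
qed

end

section \<open>Proportional representation of shapes\<close>

lemma of_nat_choose_two: "real (n choose 2) = real n * (real n - 1) / 2"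
  by (induction n) (simp_all add: numeral_2_eq_2 field_simps)

lemma of_nat_choose_three: "real (n choose 3) = real n * (real n - 1) * (real n - 2) / 6"
proof (induction n)
  case (Suc n)
  have "Suc n choose 3 = (n choose 2) + (n choose 3)" by (simp add: numeral_eq_Suc)
  then show ?case using Suc by (simp add: of_nat_choose_two field_simps)
qed simp

lemma shape_pair:
  assumes "card S = 2"
  shows "card (fst ` S) = 1 \<longleftrightarrow> shape S = (1, 2)"
    and "card (snd ` S) = 1 \<longleftrightarrow> shape S = (2, 1)"
    and "shape S \<in> {(1, 2), (2, 1), (2, 2)}"
proof -
  obtain p q where S: "S = {p, q}" "p \<noteq> q" using assms by (auto simp: card_2_iff)
  then have "fst p \<noteq> fst q \<or> snd p \<noteq> snd q" by (simp add: prod_eq_iff)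
  then show "card (fst ` S) = 1 \<longleftrightarrow> shape S = (1, 2)"
    and "card (snd ` S) = 1 \<longleftrightarrow> shape S = (2, 1)"
    and "shape S \<in> {(1, 2), (2, 1), (2, 2)}"
    unfolding S(1) shape_def by (auto simp: card_insert_if)
qed

text \<open>Distinct points in one row lie in distinct columns, so a single row forces three
  columns. Two rows and one column would have room for only two points, hence two rows leave
  \<open>(2, 2)\<close> and \<open>(2, 3)\<close>.\<close>

lemma shape_triple:
  assumes "card S = 3"
  shows "card (fst ` S) = 1 \<longleftrightarrow> shape S = (1, 3)"
    and "card (snd ` S) = 1 \<longleftrightarrow> shape S = (3, 1)"
    and "card (fst ` S) = 2 \<longleftrightarrow> shape S = (2, 2) \<or> shape S = (2, 3)"
    and "card (snd ` S) = 2 \<longleftrightarrow> shape S = (2, 2) \<or> shape S = (3, 2)"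
    and "shape S \<in> {(1, 3), (3, 1), (2, 2), (2, 3), (3, 2), (3, 3)}"
proof -
  obtain p q r where S: "S = {p, q, r}" "p \<noteq> q" "p \<noteq> r" "q \<noteq> r"
    using assms by (auto simp: card_3_iff)
  then have d: "fst p \<noteq> fst q \<or> snd p \<noteq> snd q" "fst p \<noteq> fst r \<or> snd p \<noteq> snd r"
    "fst q \<noteq> fst r \<or> snd q \<noteq> snd r" by (simp_all add: prod_eq_iff)
  have sh: "shape S = (card {fst p, fst q, fst r}, card {snd p, snd q, snd r})"
    "card (fst ` S) = card {fst p, fst q, fst r}" "card (snd ` S) = card {snd p, snd q, snd r}"
    by (simp_all add: shape_def S(1))
  have "(card (fst ` S) = 1 \<longleftrightarrow> shape S = (1, 3)) \<and> (card (snd ` S) = 1 \<longleftrightarrow> shape S = (3, 1)) \<and>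
    (card (fst ` S) = 2 \<longleftrightarrow> shape S = (2, 2) \<or> shape S = (2, 3)) \<and>
    (card (snd ` S) = 2 \<longleftrightarrow> shape S = (2, 2) \<or> shape S = (3, 2)) \<and>
    shape S \<in> {(1, 3), (3, 1), (2, 2), (2, 3), (3, 2), (3, 3)}"
    by (cases "fst p = fst q"; cases "fst q = fst r"; cases "fst p = fst r";
        cases "snd p = snd q"; cases "snd q = snd r"; cases "snd p = snd r")
       (use d in \<open>simp_all add: sh card_insert3\<close>)
  then show "card (fst ` S) = 1 \<longleftrightarrow> shape S = (1, 3)"
    and "card (snd ` S) = 1 \<longleftrightarrow> shape S = (3, 1)"
    and "card (fst ` S) = 2 \<longleftrightarrow> shape S = (2, 2) \<or> shape S = (2, 3)"
    and "card (snd ` S) = 2 \<longleftrightarrow> shape S = (2, 2) \<or> shape S = (3, 2)"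
    and "shape S \<in> {(1, 3), (3, 1), (2, 2), (2, 3), (3, 2), (3, 3)}"
    by blast+
qed

definition shape_count :: "nat \<Rightarrow> ('a \<times> 'b) set \<Rightarrow> nat \<times> nat \<Rightarrow> nat" where
  "shape_count t A i = card {S. S \<subseteq> A \<and> card S = t \<and> shape S = i}"

lemma sum_shape_count:
  fixes A :: "('a \<times> 'b) set"
  assumes "finite A" "finite I" "\<And>S :: ('a \<times> 'b) set. card S = t \<Longrightarrow> shape S \<in> I"
  shows "(\<Sum>i\<in>I. shape_count t A i) = card A choose t"
proof -
  have "{S. S \<subseteq> A \<and> card S = t} = (\<Union>i\<in>I. {S. S \<subseteq> A \<and> card S = t \<and> shape S = i})"
    using assms(3) by auto
  moreover have "card (\<Union>i\<in>I. {S. S \<subseteq> A \<and> card S = t \<and> shape S = i}) = (\<Sum>i\<in>I. shape_count t A i)"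
    unfolding shape_count_def by (rule card_UN_disjoint) (use assms in auto)
  ultimately show ?thesis using n_subsets[OF \<open>finite A\<close>, of t] by metis
qed

lemma shape_count_outside:
  fixes A :: "('a \<times> 'b) set"
  assumes "\<And>S :: ('a \<times> 'b) set. card S = t \<Longrightarrow> shape S \<in> I" "i \<notin> I"
  shows "shape_count t A i = 0"
proof -
  have "{S. S \<subseteq> A \<and> card S = t \<and> shape S = i} = {}" using assms by auto
  then show ?thesis unfolding shape_count_def by (metis card.empty)
qed

lemma shape_count_constant:
  "shape_count 2 A (1, 2) = card {S. S \<subseteq> A \<and> card S = 2 \<and> card (fst ` S) = 1}"
  "shape_count 2 A (2, 1) = card {S. S \<subseteq> A \<and> card S = 2 \<and> card (snd ` S) = 1}"
  "shape_count 3 A (1, 3) = card {S. S \<subseteq> A \<and> card S = 3 \<and> card (fst ` S) = 1}"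
  "shape_count 3 A (3, 1) = card {S. S \<subseteq> A \<and> card S = 3 \<and> card (snd ` S) = 1}"
  unfolding shape_count_def
  by (rule arg_cong[where f = card], rule Collect_cong,
      use shape_pair(1,2) shape_triple(1,2) in blast)+

text \<open>Extension of pairs, applied to rows and to columns. Triples in exactly two rows are
  3-paths or have shape \<open>(2, 3)\<close>; for columns the second shape is
  \<open>(3, 2)\<close>.\<close>

lemma shape_count_extension:
  assumes "finite A"
  shows "shape_count 2 A (1, 2) * (card A - 2)
      = 3 * shape_count 3 A (1, 3) + shape_count 3 A (2, 2) + shape_count 3 A (2, 3)"
    and "shape_count 2 A (2, 1) * (card A - 2)
      = 3 * shape_count 3 A (3, 1) + shape_count 3 A (2, 2) + shape_count 3 A (3, 2)"
proof -
  have add: "card {S. S \<subseteq> A \<and> card S = 3 \<and> Q S} = shape_count 3 A i + shape_count 3 A j"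
    if "\<And>S. card S = 3 \<Longrightarrow> Q S \<longleftrightarrow> shape S = i \<or> shape S = j" "i \<noteq> j" for Q i j
  proof -
    have "{S. S \<subseteq> A \<and> card S = 3 \<and> Q S} = {S. S \<subseteq> A \<and> card S = 3 \<and> shape S = i}
      \<union> {S. S \<subseteq> A \<and> card S = 3 \<and> shape S = j}" using that(1) by blast
    moreover have "{S. S \<subseteq> A \<and> card S = 3 \<and> shape S = i}
      \<inter> {S. S \<subseteq> A \<and> card S = 3 \<and> shape S = j} = {}" using that(2) by blast
    ultimately show ?thesis
      using \<open>finite A\<close> by (simp add: shape_count_def card_Un_disjoint)
  qed
  show "shape_count 2 A (1, 2) * (card A - 2)
      = 3 * shape_count 3 A (1, 3) + shape_count 3 A (2, 2) + shape_count 3 A (2, 3)"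
    unfolding shape_count_constant card_constant_pairs_extension[OF assms]
    by (subst add[of _ "(2, 2)" "(2, 3)"]) (simp_all add: shape_triple(3))
  show "shape_count 2 A (2, 1) * (card A - 2)
      = 3 * shape_count 3 A (3, 1) + shape_count 3 A (2, 2) + shape_count 3 A (3, 2)"
    unfolding shape_count_constant card_constant_pairs_extension[OF assms]
    by (subst add[of _ "(2, 2)" "(3, 2)"]) (simp_all add: shape_triple(4))
qed

section \<open>Reduction to independent proportionality conditions\<close>

definition proportional :: "nat \<Rightarrow> ('a \<times> 'b) set \<Rightarrow> ('a \<times> 'b) set \<Rightarrow> nat \<times> nat \<Rightarrow> bool" where
  "proportional t A P i \<longleftrightarrow>
    shape_count t A i * (card P choose t) = shape_count t P i * (card A choose t)"

text \<open>The total number of pairs is trivially proportional, so the third shape is determined by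
  the other two.\<close>

lemma all_proportional_2:
  assumes "finite A" "finite P"
  shows "(\<forall>i. proportional 2 A P i) \<longleftrightarrow> proportional 2 A P (1, 2) \<and> proportional 2 A P (2, 1)"
    (is "_ \<longleftrightarrow> ?R")
proof
  assume R: ?R
  let ?I = "{(1, 2), (2, 1), (2, 2)} :: (nat \<times> nat) set"
  have total: "real (shape_count 2 C (2, 2))
    = real (card C choose 2) - real (shape_count 2 C (1, 2)) - real (shape_count 2 C (2, 1))"
    if "finite C" for C :: "('a \<times> 'b) set"
  proof -
    have "(\<Sum>i\<in>?I. shape_count 2 C i) = card C choose 2"
      by (rule sum_shape_count[OF that _ shape_pair(3)]) simp_all
    then show ?thesis by simp
  qed
  have "real (shape_count 2 A (2, 2) * (card P choose 2))
      = real (shape_count 2 P (2, 2) * (card A choose 2))"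
  proof -
    have "real (shape_count 2 A (1, 2)) * real (card P choose 2)
        = real (shape_count 2 P (1, 2)) * real (card A choose 2)"
      "real (shape_count 2 A (2, 1)) * real (card P choose 2)
        = real (shape_count 2 P (2, 1)) * real (card A choose 2)"
      using R unfolding proportional_def of_nat_mult[symmetric] by simp_all
    then show ?thesis
      unfolding of_nat_mult total[OF assms(1)] total[OF assms(2)] left_diff_distrib by simp
  qed
  then have "proportional 2 A P (2, 2)" unfolding proportional_def of_nat_eq_iff .
  moreover have "proportional 2 A P i" if "i \<notin> ?I" for i
    unfolding proportional_def by (simp add: shape_count_outside[OF shape_pair(3) that])
  ultimately show "\<forall>i. proportional 2 A P i" using R by (metis insertE singletonD)
qed blast

text \<open>Proportionality passes through homogeneous linear relations with the same coefficients
  for \<open>A\<close> and \<open>P\<close>. The two extension relations and the total are such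
  relations once \<open>card - 2\<close> is absorbed into the pair counts.\<close>

lemma all_proportional_3:
  assumes "finite A" "finite P" "3 \<le> card A" "3 \<le> card P"
  shows "(\<forall>i. proportional 3 A P i) \<longleftrightarrow>
    proportional 2 A P (1, 2) \<and> proportional 2 A P (2, 1) \<and>
    proportional 3 A P (1, 3) \<and> proportional 3 A P (3, 1) \<and> proportional 3 A P (2, 2)"
    (is "?L \<longleftrightarrow> ?R")
proof -
  define n where "n = (\<lambda>t C i. real (shape_count t (C :: ('a \<times> 'b) set) i))"
  define c2 where "c2 = (\<lambda>C :: ('a \<times> 'b) set. real (card C choose 2))"
  define c3 where "c3 = (\<lambda>C :: ('a \<times> 'b) set. real (card C choose 3))"
  define d where "d = (\<lambda>C :: ('a \<times> 'b) set. real (card C) - 2)"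
  let ?I = "{(1, 3), (3, 1), (2, 2), (2, 3), (3, 2), (3, 3)} :: (nat \<times> nat) set"
  have p2: "proportional 2 A P i \<longleftrightarrow> n 2 A i * c2 P = n 2 P i * c2 A" for i
    unfolding proportional_def n_def c2_def of_nat_mult[symmetric] of_nat_eq_iff ..
  have p3: "proportional 3 A P i \<longleftrightarrow> n 3 A i * c3 P = n 3 P i * c3 A" for i
    unfolding proportional_def n_def c3_def of_nat_mult[symmetric] of_nat_eq_iff ..
  have rel: "n 2 C (1, 2) * d C = 3 * n 3 C (1, 3) + n 3 C (2, 2) + n 3 C (2, 3)"
    "n 2 C (2, 1) * d C = 3 * n 3 C (3, 1) + n 3 C (2, 2) + n 3 C (3, 2)"
    "c2 C * d C = 3 * c3 C" "d C > 0" "c2 C > 0" "c3 C > 0"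
    "n 3 C (3, 3) = c3 C - n 3 C (1, 3) - n 3 C (3, 1) - n 3 C (2, 2) - n 3 C (2, 3) - n 3 C (3, 2)"
    if "finite C" "3 \<le> card C" for C :: "('a \<times> 'b) set"
  proof -
    have "real (card C - 2) = d C" using that by (simp add: d_def)
    then show "n 2 C (1, 2) * d C = 3 * n 3 C (1, 3) + n 3 C (2, 2) + n 3 C (2, 3)"
      "n 2 C (2, 1) * d C = 3 * n 3 C (3, 1) + n 3 C (2, 2) + n 3 C (3, 2)"
      using shape_count_extension[OF that(1), THEN arg_cong[where f = real]]
      by (simp_all add: n_def)
    show "c2 C * d C = 3 * c3 C"
      by (simp add: c2_def c3_def d_def of_nat_choose_two of_nat_choose_three)
    show "d C > 0" using that by (simp add: d_def)
    show "c2 C > 0" "c3 C > 0" using that by (simp_all add: c2_def c3_def)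
    show "n 3 C (3, 3) = c3 C - n 3 C (1, 3) - n 3 C (3, 1) - n 3 C (2, 2) - n 3 C (2, 3) - n 3 C (3, 2)"
    proof -
      have "(\<Sum>i\<in>?I. shape_count 3 C i) = card C choose 3"
        by (rule sum_shape_count[OF that(1) _ shape_triple(5)]) simp_all
      then show ?thesis by (simp add: n_def c3_def)
    qed
  qed
  note A = rel[OF assms(1,3)] and P = rel[OF assms(2,4)]
  \<comment> \<open>Since \<open>c2 C * d C = 3 * c3 C\<close>, multiplying by the positive number
    \<open>d A * d P\<close> turns proportionality of pairs into a statement normalised by the
    number of triples.\<close>
  have scale: "n 2 A i * c2 P = n 2 P i * c2 A
    \<longleftrightarrow> (n 2 A i * d A) * c3 P = (n 2 P i * d P) * c3 A" for i
  proof -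
    have "(n 2 A i * d A) * (3 * c3 P) = (n 2 P i * d P) * (3 * c3 A)
      \<longleftrightarrow> (d A * d P) * (n 2 A i * c2 P) = (d A * d P) * (n 2 P i * c2 A)"
      unfolding A(3)[symmetric] P(3)[symmetric] by (simp only: mult_ac)
    then show ?thesis using A(4) P(4) by (simp add: mult.assoc)
  qed
  show ?thesis
  proof
    assume L: ?L
    then have L: "n 3 A i * c3 P = n 3 P i * c3 A" for i using p3 by blast
    show ?R unfolding p2 p3 scale A(1,2) P(1,2) using L by (simp add: distrib_right)
  next
    assume R: ?R
    then have e: "n 3 A (1, 3) * c3 P = n 3 P (1, 3) * c3 A"
      "n 3 A (3, 1) * c3 P = n 3 P (3, 1) * c3 A" "n 3 A (2, 2) * c3 P = n 3 P (2, 2) * c3 A"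
      unfolding p3 by blast+
    have e': "n 3 A (2, 3) * c3 P = n 3 P (2, 3) * c3 A" "n 3 A (3, 2) * c3 P = n 3 P (3, 2) * c3 A"
      using R e unfolding p2 scale A(1,2) P(1,2) by (simp_all add: distrib_right)
    have "n 3 A (3, 3) * c3 P = n 3 P (3, 3) * c3 A"
      unfolding A(7) P(7) left_diff_distrib e e' by simp
    with e e' have "proportional 3 A P i" if "i \<in> ?I" for i using that unfolding p3 by blast
    moreover have "proportional 3 A P i" if "i \<notin> ?I" for i
      unfolding proportional_def by (simp add: shape_count_outside[OF shape_triple(5) that])
    ultimately show ?L by blast
  qed
qed

section \<open>Counts in the full grid and the resulting constants\<close>

lemma full_counts:
  assumes "finite X" "finite Y"
  shows "shape_count 2 (X \<times> Y) (1, 2) = card X * (card Y choose 2)"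
    and "shape_count 2 (X \<times> Y) (2, 1) = card Y * (card X choose 2)"
    and "shape_count 3 (X \<times> Y) (1, 3) = card X * (card Y choose 3)"
    and "shape_count 3 (X \<times> Y) (3, 1) = card Y * (card X choose 3)"
    and "shape_count 3 (X \<times> Y) (2, 2) = 4 * (card X choose 2) * (card Y choose 2)"
proof -
  have row: "card {p \<in> X \<times> Y. fst p = r} = card Y" if "r \<in> X" for r
  proof -
    have "{p \<in> X \<times> Y. fst p = r} = {r} \<times> Y" using that by auto
    then show ?thesis by (simp add: card_cartesian_product)
  qed
  have col: "card {p \<in> X \<times> Y. snd p = c} = card X" if "c \<in> Y" for c
  proof -
    have "{p \<in> X \<times> Y. snd p = c} = X \<times> {c}" using that by auto
    then show ?thesis by (simp add: card_cartesian_product)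
  qed
  have f: "card {S. S \<subseteq> X \<times> Y \<and> card S = t \<and> card (fst ` S) = 1} = card X * (card Y choose t)"
    if "0 < t" for t
    using card_constant_subsets[of "X \<times> Y" X fst t] assms that row by auto
  have s: "card {S. S \<subseteq> X \<times> Y \<and> card S = t \<and> card (snd ` S) = 1} = card Y * (card X choose t)"
    if "0 < t" for t
    using card_constant_subsets[of "X \<times> Y" Y snd t] assms that col by auto
  show "shape_count 2 (X \<times> Y) (1, 2) = card X * (card Y choose 2)"
    "shape_count 2 (X \<times> Y) (2, 1) = card Y * (card X choose 2)"
    "shape_count 3 (X \<times> Y) (1, 3) = card X * (card Y choose 3)"
    "shape_count 3 (X \<times> Y) (3, 1) = card Y * (card X choose 3)"
    unfolding shape_count_constant by (rule f, simp, rule s, simp, rule f, simp, rule s, simp)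
  show "shape_count 3 (X \<times> Y) (2, 2) = 4 * (card X choose 2) * (card Y choose 2)"
    unfolding shape_count_def by (rule card_triples_shape_2_2[OF assms])
qed

text \<open>The right-hand sides are real quotients that may fail to be integers, in which case
  neither side of the equivalence holds. The bound on \<open>m\<close> keeps all cancelled factors
  nonzero.\<close>

lemma proportion_iff:
  fixes m n k :: nat
  assumes "3 \<le> m"
  shows "n * (m\<^sup>2 choose 2) = m * (m choose 2) * (k choose 2) \<longleftrightarrow>
      real n = real k * (real k - 1) / (2 * (real m + 1))" (is ?pair)
    and "n * (m\<^sup>2 choose 3) = m * (m choose 3) * (k choose 3) \<longleftrightarrow>
      real n = real k * (real k - 1) * (real k - 2) * (real m - 2) /
        (6 * (real m + 1) * (real m ^ 2 - 2))" (is ?claw)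
    and "n * (m\<^sup>2 choose 3) = 4 * (m choose 2) * (m choose 2) * (k choose 3) \<longleftrightarrow>
      real n = real k * (real k - 1) * (real k - 2) * (real m - 1) /
        ((real m + 1) * (real m ^ 2 - 2))" (is ?path)
proof -
  define M where "M = real m"
  have M: "M \<ge> 3" using assms by (simp add: M_def)
  then have sq: "M\<^sup>2 \<ge> 3\<^sup>2" by (intro power_mono) auto
  have nz: "M \<noteq> 0" "M - 1 \<noteq> 0" "M + 1 \<noteq> 0" "M\<^sup>2 - 2 \<noteq> 0" using M sq by auto
  have c: "real (m\<^sup>2 choose 2) = M * (M * (M - 1) / 2) * (M + 1)"
    "real (m\<^sup>2 choose 3) = M\<^sup>2 * (M - 1) * (M + 1) * (M\<^sup>2 - 2) / 6"
    by (simp_all add: of_nat_choose_two of_nat_choose_three M_def field_simps power2_eq_square)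
  show ?pair
    unfolding of_nat_eq_iff[where 'a = real, symmetric] of_nat_mult c
    unfolding of_nat_choose_two M_def[symmetric]
  proof -
    \<comment> \<open>Clearing denominators exposes the factor \<open>M^2 * (M - 1)\<close> on both
      sides; the other two equivalences share it.\<close>
    have "real n * (M * (M * (M - 1) / 2) * (M + 1))
        = M * (M * (M - 1) / 2) * (real k * (real k - 1) / 2)
      \<longleftrightarrow> (M\<^sup>2 * (M - 1)) * (real n * (2 * (M + 1))) = (M\<^sup>2 * (M - 1)) * (real k * (real k - 1))"
    proof -
      have "real n * (M * (M * (M - 1) / 2) * (M + 1)) = (M\<^sup>2 * (M - 1)) * (real n * (2 * (M + 1))) / 4"
        "M * (M * (M - 1) / 2) * (real k * (real k - 1) / 2)
          = (M\<^sup>2 * (M - 1)) * (real k * (real k - 1)) / 4"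
        by (simp_all add: power2_eq_square field_simps)
      then show ?thesis by (simp only: divide_cancel_right) simp
    qed
    also have "\<dots> \<longleftrightarrow> real n * (2 * (M + 1)) = real k * (real k - 1)"
      using nz(1,2) by simp
    also have "\<dots> \<longleftrightarrow> real n = real k * (real k - 1) / (2 * (M + 1))"
      using nz(3) by (subst eq_divide_eq) simp
    finally show "real n * (M * (M * (M - 1) / 2) * (M + 1))
        = M * (M * (M - 1) / 2) * (real k * (real k - 1) / 2) \<longleftrightarrow>
      real n = real k * (real k - 1) / (2 * (M + 1))" .
  qed
  show ?claw
    unfolding of_nat_eq_iff[where 'a = real, symmetric] of_nat_mult c
    unfolding of_nat_choose_three M_def[symmetric]
  proof -
    have "real n * (M\<^sup>2 * (M - 1) * (M + 1) * (M\<^sup>2 - 2) / 6)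
        = M * (M * (M - 1) * (M - 2) / 6) * (real k * (real k - 1) * (real k - 2) / 6)
      \<longleftrightarrow> (M\<^sup>2 * (M - 1)) * (real n * (6 * (M + 1) * (M\<^sup>2 - 2)))
        = (M\<^sup>2 * (M - 1)) * (real k * (real k - 1) * (real k - 2) * (M - 2))"
    proof -
      have "real n * (M\<^sup>2 * (M - 1) * (M + 1) * (M\<^sup>2 - 2) / 6) = (M\<^sup>2 * (M - 1)) * (real n * (6 * (M + 1) * (M\<^sup>2 - 2))) / 36"
        "M * (M * (M - 1) * (M - 2) / 6) * (real k * (real k - 1) * (real k - 2) / 6)
          = (M\<^sup>2 * (M - 1)) * (real k * (real k - 1) * (real k - 2) * (M - 2)) / 36"
        by (simp_all add: power2_eq_square field_simps)
      then show ?thesis by (simp only: divide_cancel_right) simp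
    qed
    also have "\<dots> \<longleftrightarrow> real n * (6 * (M + 1) * (M\<^sup>2 - 2)) = real k * (real k - 1) * (real k - 2) * (M - 2)"
      using nz(1,2) by simp
    also have "\<dots> \<longleftrightarrow> real n = real k * (real k - 1) * (real k - 2) * (M - 2) / (6 * (M + 1) * (M\<^sup>2 - 2))"
      using nz(3,4) by (subst eq_divide_eq) simp
    finally show "real n * (M\<^sup>2 * (M - 1) * (M + 1) * (M\<^sup>2 - 2) / 6)
        = M * (M * (M - 1) * (M - 2) / 6) * (real k * (real k - 1) * (real k - 2) / 6) \<longleftrightarrow>
      real n = real k * (real k - 1) * (real k - 2) * (M - 2) / (6 * (M + 1) * (M\<^sup>2 - 2))" .
  qed
  show ?path
    unfolding of_nat_eq_iff[where 'a = real, symmetric] of_nat_mult c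
    unfolding of_nat_choose_three of_nat_choose_two M_def[symmetric]
  proof -
    have "real n * (M\<^sup>2 * (M - 1) * (M + 1) * (M\<^sup>2 - 2) / 6)
        = real 4 * (M * (M - 1) / 2) * (M * (M - 1) / 2) * (real k * (real k - 1) * (real k - 2) / 6)
      \<longleftrightarrow> (M\<^sup>2 * (M - 1)) * (real n * ((M + 1) * (M\<^sup>2 - 2)))
        = (M\<^sup>2 * (M - 1)) * (real k * (real k - 1) * (real k - 2) * (M - 1))"
    proof -
      have "real n * (M\<^sup>2 * (M - 1) * (M + 1) * (M\<^sup>2 - 2) / 6) = (M\<^sup>2 * (M - 1)) * (real n * ((M + 1) * (M\<^sup>2 - 2))) / 6"
        "real 4 * (M * (M - 1) / 2) * (M * (M - 1) / 2) * (real k * (real k - 1) * (real k - 2) / 6)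
          = (M\<^sup>2 * (M - 1)) * (real k * (real k - 1) * (real k - 2) * (M - 1)) / 6"
        by (simp_all add: power2_eq_square field_simps)
      then show ?thesis by (simp only: divide_cancel_right) simp
    qed
    also have "\<dots> \<longleftrightarrow> real n * ((M + 1) * (M\<^sup>2 - 2)) = real k * (real k - 1) * (real k - 2) * (M - 1)"
      using nz(1,2) by simp
    also have "\<dots> \<longleftrightarrow> real n = real k * (real k - 1) * (real k - 2) * (M - 1) / ((M + 1) * (M\<^sup>2 - 2))"
      using nz(3,4) by (subst eq_divide_eq) simp
    finally show "real n * (M\<^sup>2 * (M - 1) * (M + 1) * (M\<^sup>2 - 2) / 6)
        = real 4 * (M * (M - 1) / 2) * (M * (M - 1) / 2) * (real k * (real k - 1) * (real k - 2) / 6) \<longleftrightarrow>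
      real n = real k * (real k - 1) * (real k - 2) * (M - 1) / ((M + 1) * (M\<^sup>2 - 2))" .
  qed
qed

text \<open>Here \<open>(m!)^2 = m^2 (m-1) (m-1)! (m-2)!\<close>, and the factor
  \<open>m^2 (m-1)\<close> also divides the numerators of both binomials of \<open>m^2\<close>.
  Cancelling it leaves the asymmetric product of factorials.\<close>

lemma lambda_eq:
  fixes m k l s :: nat
  assumes "3 \<le> m" "s > 0"
  shows "l * s * (m\<^sup>2 choose 2) = fact m * fact m * (k choose 2) \<Longrightarrow>
      real l = real k * (real k - 1) * fact (m - 1) * fact (m - 2) / ((real m + 1) * real s)"
    and "l * s * (m\<^sup>2 choose 3) = fact m * fact m * (k choose 3) \<Longrightarrow>
      real l = real k * (real k - 1) * (real k - 2) * fact (m - 1) * fact (m - 2) /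
        ((real m + 1) * (real m ^ 2 - 2) * real s)"
proof -
  define M where "M = real m"
  define f where "f = (fact (m - 2) :: real)"
  have M: "M \<ge> 3" using assms by (simp add: M_def)
  then have sq: "M\<^sup>2 \<ge> 3\<^sup>2" by (intro power_mono) auto
  have nz: "M \<noteq> 0" "M - 1 \<noteq> 0" "M + 1 \<noteq> 0" "M\<^sup>2 - 2 \<noteq> 0" "real s \<noteq> 0" using M sq assms by auto
  \<comment> \<open>This form of \<open>m\<close> lets the natural subtractions inside the
    factorials evaluate.\<close>
  obtain j where j: "m = Suc (Suc j)" using assms by (metis add_2_eq_Suc le_Suc_ex numeral_3_eq_3 add_Suc)
  have facts: "(fact (m - 1) :: real) = (M - 1) * f" "(fact m :: real) = M * (M - 1) * f"
    unfolding M_def f_def j by (simp_all add: field_simps)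
  have c: "real (m\<^sup>2 choose 2) = M\<^sup>2 * (M - 1) * (M + 1) / 2"
    "real (m\<^sup>2 choose 3) = M\<^sup>2 * (M - 1) * (M + 1) * (M\<^sup>2 - 2) / 6"
    by (simp_all add: of_nat_choose_two of_nat_choose_three M_def field_simps power2_eq_square)
  show "real l = real k * (real k - 1) * fact (m - 1) * fact (m - 2) / ((real m + 1) * real s)"
    if "l * s * (m\<^sup>2 choose 2) = fact m * fact m * (k choose 2)"
  proof -
    have "real l * real s * real (m\<^sup>2 choose 2) = fact m * fact m * real (k choose 2)"
      using arg_cong[OF that, of real] by simp
    then have e: "real l * real s * (M\<^sup>2 * (M - 1) * (M + 1) / 2)
      = M * (M - 1) * f * (M * (M - 1) * f) * (real k * (real k - 1) / 2)"
      unfolding c facts unfolding of_nat_choose_two .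
    have "(M\<^sup>2 * (M - 1)) * (real l * ((M + 1) * real s))
      = 2 * (real l * real s * (M\<^sup>2 * (M - 1) * (M + 1) / 2))" by simp
    also have "\<dots> = (M\<^sup>2 * (M - 1)) * (real k * (real k - 1) * ((M - 1) * f) * f)"
      unfolding e by (simp add: power2_eq_square)
    finally have "(M\<^sup>2 * (M - 1)) * (real l * ((M + 1) * real s))
      = (M\<^sup>2 * (M - 1)) * (real k * (real k - 1) * ((M - 1) * f) * f)" .
    then have "real l * ((M + 1) * real s) = real k * (real k - 1) * ((M - 1) * f) * f"
      using nz(1,2) by simp
    then show ?thesis using nz(3,5)
      unfolding facts f_def[symmetric] M_def[symmetric] by (subst eq_divide_eq) simp
  qed
  show "real l = real k * (real k - 1) * (real k - 2) * fact (m - 1) * fact (m - 2) /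
      ((real m + 1) * (real m ^ 2 - 2) * real s)"
    if "l * s * (m\<^sup>2 choose 3) = fact m * fact m * (k choose 3)"
  proof -
    have "real l * real s * real (m\<^sup>2 choose 3) = fact m * fact m * real (k choose 3)"
      using arg_cong[OF that, of real] by simp
    then have e: "real l * real s * (M\<^sup>2 * (M - 1) * (M + 1) * (M\<^sup>2 - 2) / 6)
      = M * (M - 1) * f * (M * (M - 1) * f) * (real k * (real k - 1) * (real k - 2) / 6)"
      unfolding c facts unfolding of_nat_choose_three .
    have "(M\<^sup>2 * (M - 1)) * (real l * ((M + 1) * (M\<^sup>2 - 2) * real s))
      = 6 * (real l * real s * (M\<^sup>2 * (M - 1) * (M + 1) * (M\<^sup>2 - 2) / 6))" by simp
    also have "\<dots> = (M\<^sup>2 * (M - 1)) * (real k * (real k - 1) * (real k - 2) * ((M - 1) * f) * f)"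
      unfolding e by (simp add: power2_eq_square)
    finally have "(M\<^sup>2 * (M - 1)) * (real l * ((M + 1) * (M\<^sup>2 - 2) * real s))
      = (M\<^sup>2 * (M - 1)) * (real k * (real k - 1) * (real k - 2) * ((M - 1) * f) * f)" .
    then have "real l * ((M + 1) * (M\<^sup>2 - 2) * real s)
      = real k * (real k - 1) * (real k - 2) * ((M - 1) * f) * f"
      using nz(1,2) by simp
    then show ?thesis using nz(3,4,5)
      unfolding facts f_def[symmetric] M_def[symmetric] by (subst eq_divide_eq) simp
  qed
qed

section \<open>The design of a bipartite graph\<close>

context bipartite
begin

sublocale rows: one_sided \<Delta> X
proof
  show "\<exists>z\<in>X. \<exists>w. w \<notin> X \<and> e = {z, w}" if e: "e \<in> \<Delta>" for e
  proof -
    obtain r c where "r \<in> X" "c \<in> Y" "e = {r, c}"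
      using e edges by (auto simp: complete_bipartite_def)
    then show ?thesis using not_both by blast
  qed
qed (rule finite_edges fin)+

sublocale columns: one_sided \<Delta> Y
proof
  show "\<exists>z\<in>Y. \<exists>w. w \<notin> Y \<and> e = {z, w}" if e: "e \<in> \<Delta>" for e
  proof -
    obtain r c where "r \<in> X" "c \<in> Y" "e = {c, r}"
      using e edges by (auto simp: complete_bipartite_def insert_commute)
    then show ?thesis using not_both by blast
  qed
qed (rule finite_edges fin)+

lemma valency_eq:
  shows "r \<in> X \<Longrightarrow> valency \<Delta> r = card {p \<in> B. fst p = r}"
    and "c \<in> Y \<Longrightarrow> valency \<Delta> c = card {p \<in> B. snd p = c}"
proof -
  have val: "valency \<Delta> v = card {p \<in> B. Q p}" if "\<And>p. p \<in> B \<Longrightarrow> v \<in> edge_of p \<longleftrightarrow> Q p" for v Q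
  proof -
    have "{e \<in> edge_of ` B. v \<in> e} = edge_of ` {p \<in> B. Q p}" using that by auto
    then have "{e \<in> \<Delta>. v \<in> e} = edge_of ` {p \<in> B. Q p}" unfolding edge_of_B .
    moreover have "inj_on edge_of {p \<in> B. Q p}"
      by (rule inj_on_subset[OF inj_on_edge_of]) (use B_subset in auto)
    ultimately show ?thesis by (simp add: valency_def card_image)
  qed
  have sides: "fst p \<in> X" "snd p \<in> Y" if "p \<in> B" for p using that B_subset by auto
  show "valency \<Delta> r = card {p \<in> B. fst p = r}" if "r \<in> X"
  proof (rule val)
    show "r \<in> edge_of p \<longleftrightarrow> fst p = r" if "p \<in> B" for p
      using sides[OF that] \<open>r \<in> X\<close> disjoint by (auto simp: edge_of_def)
  qed
  show "valency \<Delta> c = card {p \<in> B. snd p = c}" if "c \<in> Y"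
  proof (rule val)
    show "c \<in> edge_of p \<longleftrightarrow> snd p = c" if "p \<in> B" for p
      using sides[OF that] \<open>c \<in> Y\<close> disjoint by (auto simp: edge_of_def)
  qed
qed

lemma shape_count_B:
  "shape_count 2 B (1, 2) = (\<Sum>r\<in>X. valency \<Delta> r choose 2)"
  "shape_count 2 B (2, 1) = (\<Sum>c\<in>Y. valency \<Delta> c choose 2)"
  "shape_count 3 B (1, 3) = (\<Sum>r\<in>X. valency \<Delta> r choose 3)"
  "shape_count 3 B (3, 1) = (\<Sum>c\<in>Y. valency \<Delta> c choose 3)"
  "shape_count 3 B (2, 2) = card (u_paths 3 \<Delta>)"
proof -
  have f: "card {S. S \<subseteq> B \<and> card S = t \<and> card (fst ` S) = 1} = (\<Sum>r\<in>X. valency \<Delta> r choose t)"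
    if "0 < t" for t
  proof -
    have "fst ` B \<subseteq> X" using B_subset by auto
    from card_constant_subsets[OF finite_B fin(1) this that] show ?thesis
      by (simp add: valency_eq)
  qed
  have s: "card {S. S \<subseteq> B \<and> card S = t \<and> card (snd ` S) = 1} = (\<Sum>c\<in>Y. valency \<Delta> c choose t)"
    if "0 < t" for t
  proof -
    have "snd ` B \<subseteq> Y" using B_subset by auto
    from card_constant_subsets[OF finite_B fin(2) this that] show ?thesis
      by (simp add: valency_eq)
  qed
  show "shape_count 2 B (1, 2) = (\<Sum>r\<in>X. valency \<Delta> r choose 2)"
    "shape_count 2 B (2, 1) = (\<Sum>c\<in>Y. valency \<Delta> c choose 2)"
    "shape_count 3 B (1, 3) = (\<Sum>r\<in>X. valency \<Delta> r choose 3)"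
    "shape_count 3 B (3, 1) = (\<Sum>c\<in>Y. valency \<Delta> c choose 3)"
    unfolding shape_count_constant by (rule f, simp, rule s, simp, rule f, simp, rule s, simp)
  show "shape_count 3 B (2, 2) = card (u_paths 3 \<Delta>)"
    unfolding shape_count_def card_three_paths ..
qed

text \<open>Type \<open>\<C>\<close> is introduced as the negation of type \<open>\<R>\<close>,
  whereas the counting lemma wants the middle vertex in a given side. The middle vertex is
  independent of how the path is written, being the only vertex common to its two edges.\<close>

lemma middle_vertex_sides:
  assumes "S \<in> u_paths 2 \<Delta>"
  shows "\<not> middle_vertex_in X S \<longleftrightarrow> middle_vertex_in Y S"
proof -
  obtain a b c where S: "S \<subseteq> \<Delta>" "distinct [a, b, c]" "S = {{a, b}, {b, c}}"
    using assms by (auto simp: u_paths_2)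
  have mid: "middle_vertex_in Z S \<longleftrightarrow> b \<in> Z" for Z
  proof
    assume "middle_vertex_in Z S"
    then obtain a' b' c' where *: "distinct [a', b', c']" "S = {{a', b'}, {b', c'}}" "b' \<in> Z"
      by (auto simp: middle_vertex_in_def path_edges_3)
    have "\<Inter>S = {b}" using S by auto
    moreover have "\<Inter>S = {b'}" using * by auto
    ultimately show "b \<in> Z" using * by simp
  next
    assume "b \<in> Z"
    then show "middle_vertex_in Z S"
      unfolding middle_vertex_in_def path_edges_3 using S by blast
  qed
  have "{a, b} \<in> complete_bipartite X Y" using S edges by auto
  then have "b \<in> X \<or> b \<in> Y" by (auto simp: complete_bipartite_def doubleton_eq_iff)
  then show ?thesis using mid not_both by blast
qed

text \<open>The two sides are compared with the same value separately, so equality between the row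
  and column counts is a consequence and not a further condition.\<close>

theorem design_characterization:
  fixes m k :: nat
  assumes m: "3 \<le> m" "card X = m" "card Y = m" and k: "3 \<le> k" "card \<Delta> = k"
  defines "pairs \<equiv> \<lambda>Z. real (\<Sum>z\<in>Z. valency \<Delta> z choose 2) = real k * (real k - 1) / (2 * (real m + 1))"
    and "triples \<equiv> \<lambda>Z. real (\<Sum>z\<in>Z. valency \<Delta> z choose 3) =
      real k * (real k - 1) * (real k - 2) * (real m - 2) / (6 * (real m + 1) * (real m ^ 2 - 2))"
    and "paths \<equiv> real (card (u_paths 3 \<Delta>)) =
      real k * (real k - 1) * (real k - 2) * (real m - 1) / ((real m + 1) * (real m ^ 2 - 2))"
    and "s \<equiv> card (graph_stabiliser X Y \<Delta>)"
  shows "is_t_design 2 (design_of X Y \<Delta>) \<longleftrightarrow> pairs X \<and> pairs Y"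
    and "is_t_design 2 (design_of X Y \<Delta>) \<Longrightarrow>
      \<exists>l. is_t_v_k_design 2 (m ^ 2) k l (design_of X Y \<Delta>) \<and>
        real l = real k * (real k - 1) * fact (m - 1) * fact (m - 2) / ((real m + 1) * real s)"
    and "is_t_design 3 (design_of X Y \<Delta>) \<longleftrightarrow>
      (pairs X \<and> pairs Y) \<and> (triples X \<and> triples Y) \<and> paths"
    and "is_t_design 3 (design_of X Y \<Delta>) \<Longrightarrow>
      \<exists>l. is_t_v_k_design 3 (m ^ 2) k l (design_of X Y \<Delta>) \<and>
        real l = real k * (real k - 1) * (real k - 2) * fact (m - 1) * fact (m - 2) /
          ((real m + 1) * (real m ^ 2 - 2) * real s)"
proof -
  have v: "card (X \<times> Y) = m ^ 2" using m by (simp add: card_cartesian_product power2_eq_square)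
  have finXY: "finite (X \<times> Y)" using fin by simp
  have "3 \<le> card B" using k by (simp add: card_B)
  moreover have "card B \<le> card (X \<times> Y)" by (rule card_mono[OF finXY B_subset])
  ultimately have three: "3 \<le> card B" "3 \<le> card (X \<times> Y)" by simp_all
  have "card {g \<in> point_perms X Y. g ` B = B} > 0"
    using id_G finite_G by (auto simp: card_gt_0_iff)
  then have s: "s > 0" by (simp add: s_def card_stabiliser)
  have design: "is_t_design t (design_of X Y \<Delta>) \<longleftrightarrow> (\<forall>i. proportional t B (X \<times> Y) i)"
    if "t = 2 \<or> t = 3" for t
    using design_iff(1)[of t] that k
    unfolding proportional_def shape_count_def card_B by auto
  note full = full_counts[OF fin, unfolded m]
  \<comment> \<open>With all counts inserted, the proportions are literally the left-hand sides of
    \<open>proportion_iff\<close>.\<close>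
  have conds: "proportional 2 B (X \<times> Y) (1, 2) \<longleftrightarrow> pairs X"
    "proportional 2 B (X \<times> Y) (2, 1) \<longleftrightarrow> pairs Y"
    "proportional 3 B (X \<times> Y) (1, 3) \<longleftrightarrow> triples X"
    "proportional 3 B (X \<times> Y) (3, 1) \<longleftrightarrow> triples Y"
    "proportional 3 B (X \<times> Y) (2, 2) \<longleftrightarrow> paths"
    unfolding proportional_def full shape_count_B v card_B k proportion_iff[OF m(1)]
      pairs_def triples_def paths_def by (rule refl)+
  show "is_t_design 2 (design_of X Y \<Delta>) \<longleftrightarrow> pairs X \<and> pairs Y"
    using design[of 2] all_proportional_2[OF finite_B finXY] conds by simp
  show "is_t_design 3 (design_of X Y \<Delta>) \<longleftrightarrow>
      (pairs X \<and> pairs Y) \<and> (triples X \<and> triples Y) \<and> paths"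
    using design[of 3] all_proportional_3[OF finite_B finXY three] conds by simp
  show "\<exists>l. is_t_v_k_design 2 (m ^ 2) k l (design_of X Y \<Delta>) \<and>
      real l = real k * (real k - 1) * fact (m - 1) * fact (m - 2) / ((real m + 1) * real s)"
    if "is_t_design 2 (design_of X Y \<Delta>)"
    using design_iff(2)[of 2] that k lambda_eq(1)[OF m(1) s] unfolding v m k s_def by auto
  show "\<exists>l. is_t_v_k_design 3 (m ^ 2) k l (design_of X Y \<Delta>) \<and>
      real l = real k * (real k - 1) * (real k - 2) * fact (m - 1) * fact (m - 2) /
        ((real m + 1) * (real m ^ 2 - 2) * real s)"
    if "is_t_design 3 (design_of X Y \<Delta>)"
    using design_iff(2)[of 3] that k lambda_eq(2)[OF m(1) s] unfolding v m k s_def by auto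
qed

end

theorem corollary3p2:
  fixes m k :: nat
    and R C :: "nat \<Rightarrow> 'v"
    and \<R> \<C> :: "'v set"
    and \<Delta> :: "'v set set"
    and x y :: "nat \<Rightarrow> nat"
    and cond_a cond_i cond_ii :: bool
  assumes "m > 0" and "k > 0"
    and "3 \<le> k" and "real k \<le> real m ^ 2 / 2"
    and "inj_on R {1..m}" and "inj_on C {1..m}"
  defines "\<R> \<equiv> R ` {1..m}"
    and "\<C> \<equiv> C ` {1..m}"
  assumes "\<R> \<inter> \<C> = {}"
    and "\<Delta> \<subseteq> complete_bipartite \<R> \<C>"
    and "card \<Delta> = k"
  defines "x \<equiv> \<lambda>i. valency \<Delta> (R i)"
    and "y \<equiv> \<lambda>j. valency \<Delta> (C j)"
    and "cond_a \<equiv>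
      card {S \<in> u_paths 2 \<Delta>. middle_vertex_in \<R> S} =
        card {S \<in> u_paths 2 \<Delta>. \<not> middle_vertex_in \<R> S} \<and>
      card {S \<in> u_paths 2 \<Delta>. middle_vertex_in \<R> S} = (\<Sum>i = 1..m. x i choose 2) \<and>
      (\<Sum>i = 1..m. x i choose 2) = (\<Sum>j = 1..m. y j choose 2) \<and>
      real (\<Sum>j = 1..m. y j choose 2) = real k * (real k - 1) / (2 * (real m + 1))"
    and "cond_i \<equiv>
      card (three_claws_of_type \<R> \<Delta>) = card (three_claws_of_type \<C> \<Delta>) \<and>
      card (three_claws_of_type \<R> \<Delta>) = (\<Sum>i = 1..m. x i choose 3) \<and>
      (\<Sum>i = 1..m. x i choose 3) = (\<Sum>j = 1..m. y j choose 3) \<and>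
      real (\<Sum>j = 1..m. y j choose 3) =
        real k * (real k - 1) * (real k - 2) * (real m - 2) /
          (6 * (real m + 1) * (real m ^ 2 - 2))"
    and "cond_ii \<equiv>
      real (card (u_paths 3 \<Delta>)) =
        real k * (real k - 1) * (real k - 2) * (real m - 1) /
          ((real m + 1) * (real m ^ 2 - 2))"
  shows
    "(is_t_design 2 (design_of \<R> \<C> \<Delta>) \<longleftrightarrow> cond_a) \<and>
     (cond_a \<longrightarrow>
       (\<exists>l. is_t_v_k_design 2 (m ^ 2) k l (design_of \<R> \<C> \<Delta>) \<and>
         real l = real k * (real k - 1) * fact (m - 1) * fact (m - 2) /
           ((real m + 1) * real (card (graph_stabiliser \<R> \<C> \<Delta>))))) \<and>
     (is_t_design 3 (design_of \<R> \<C> \<Delta>) \<longleftrightarrow> cond_a \<and> cond_i \<and> cond_ii) \<and>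
     (cond_a \<and> cond_i \<and> cond_ii \<longrightarrow>
       (\<exists>l. is_t_v_k_design 3 (m ^ 2) k l (design_of \<R> \<C> \<Delta>) \<and>
         real l = real k * (real k - 1) * (real k - 2) * fact (m - 1) * fact (m - 2) /
           ((real m + 1) * (real m ^ 2 - 2) * real (card (graph_stabiliser \<R> \<C> \<Delta>)))))"
proof -
  have \<R>: "\<R> = R ` {1..m}" and \<C>: "\<C> = C ` {1..m}" using assms by simp_all
  \<comment> \<open>For \<open>m \<le> 2\<close> the upper bound on \<open>k\<close> would give
    \<open>k \<le> 2\<close>.\<close>
  have "2 < m"
  proof (rule ccontr)
    assume "\<not> 2 < m"
    then have "real m ^ 2 \<le> 2 ^ 2" by (intro power_mono) auto
    then show False using \<open>3 \<le> k\<close> \<open>real k \<le> real m ^ 2 / 2\<close> by simp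
  qed
  then have m: "3 \<le> m" by simp
  interpret bipartite \<R> \<C> \<Delta>
    by unfold_locales (use assms in auto)
  have card_sides: "card \<R> = m" "card \<C> = m"
    using \<open>inj_on R {1..m}\<close> \<open>inj_on C {1..m}\<close> by (simp_all add: \<R> \<C> card_image)
  have sums: "(\<Sum>i = 1..m. x i choose t) = (\<Sum>r\<in>\<R>. valency \<Delta> r choose t)"
    "(\<Sum>j = 1..m. y j choose t) = (\<Sum>c\<in>\<C>. valency \<Delta> c choose t)" for t
    using \<open>inj_on R {1..m}\<close> \<open>inj_on C {1..m}\<close>
    by (simp_all add: \<R> \<C> sum.reindex x_def y_def)
  have "{S \<in> u_paths 2 \<Delta>. \<not> middle_vertex_in \<R> S} = {S \<in> u_paths 2 \<Delta>. middle_vertex_in \<C> S}"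
    using middle_vertex_sides by blast
  \<comment> \<open>The path counts always equal the valency sums, so the chain of equalities only
    says that both sums have the stated value.\<close>
  then have "cond_a \<longleftrightarrow>
    real (\<Sum>r\<in>\<R>. valency \<Delta> r choose 2) = real k * (real k - 1) / (2 * (real m + 1)) \<and>
    real (\<Sum>c\<in>\<C>. valency \<Delta> c choose 2) = real k * (real k - 1) / (2 * (real m + 1))"
    unfolding cond_a_def sums rows.card_two_paths columns.card_two_paths
    by (metis of_nat_eq_iff columns.card_two_paths)
  moreover have "cond_i \<longleftrightarrow>
    real (\<Sum>r\<in>\<R>. valency \<Delta> r choose 3) = real k * (real k - 1) * (real k - 2) * (real m - 2) /
      (6 * (real m + 1) * (real m ^ 2 - 2)) \<and>
    real (\<Sum>c\<in>\<C>. valency \<Delta> c choose 3) = real k * (real k - 1) * (real k - 2) * (real m - 2) /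
      (6 * (real m + 1) * (real m ^ 2 - 2))"
    unfolding cond_i_def sums rows.card_claws columns.card_claws by (metis of_nat_eq_iff)
  ultimately show ?thesis
    using design_characterization[OF m card_sides \<open>3 \<le> k\<close> \<open>card \<Delta> = k\<close>] unfolding cond_ii_def by metis
qed

end
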